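(* For $n\ge 1$ let $$a_n := \frac{n+1}{2\log 2}-\frac12,\qquad b_n := \frac{1-\log 2}{(2\log 2)^2}\,(n+1)-\frac14,\qquad c_n := \frac{\sqrt n\,(2-3\log 2)}{(2\sqrt{b_n}\,\log 2)^3}\,(n+1).$$ Then $$\frac{2\sqrt{b_n}\; j!\,(\log 2)^{n+1}}{n!}\left\{ {n \atop j}\right\} = \frac{1}{\sqrt{2\pi}}\,e^{-x^2/2}\left(1+\frac{c_n\,(x^3-3x)}{6\sqrt n}\right)+o\left(\frac1{\sqrt n}\right)$$ as $n\to\infty$, uniformly in $j\in\mathbb{Z}$, where $x=(j-a_n)/\sqrt{b_n}$.
   Context: The Stirling numbers of the second kind $\left\{ {n \atop j}\right\}$, for non-negative integers $n,j$, are defined by $\left\{ {n \atop j}\right\}=\left\{ {n-1 \atop j-1}\right\}+j\left\{ {n-1 \atop j}\right\}$ for $n,j\ge1$, with $\left\{ {n \atop 0}\right\}=\delta_{n,0}$ and $\left\{ {0 \atop j}\right\}=\delta_{0,j}$ (Kronecker delta). In particular $\left\{ {n \atop j}\right\}=0$ for $j>n$. For negative integers $j$ the product $j!\left\{ {n \atop j}\right\}$ is understood to be $0$. Here $\log$ is the natural logarithm. Uniformity in $j\in\mathbb{Z}$ means that the supremum over $j\in\mathbb{Z}$ of the absolute value of the error term, multiplied by $\sqrt n$, tends to $0$ as $n\to\infty$. *)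

theory Defs
  imports "HOL-Analysis.Analysis" "HOL-Combinatorics.Stirling"
begin

definition mean_a :: "nat \<Rightarrow> real"
  where "mean_a n = (real n + 1) / (2 * ln 2) - 1 / 2"

definition var_b :: "nat \<Rightarrow> real"
  where "var_b n = (1 - ln 2) / (2 * ln 2) ^ 2 * (real n + 1) - 1 / 4"

definition skew_c :: "nat \<Rightarrow> real"
  where "skew_c n =
    sqrt (real n) * (2 - 3 * ln 2) / (2 * sqrt (var_b n) * ln 2) ^ 3 * (real n + 1)"

text \<open>The product \<open>j! S(n,j)\<close> for integer \<open>j\<close>; for negative \<open>j\<close> it is 0 by convention.
  Here \<open>S(n,j)\<close> is the Stirling number of the second kind, the library constant
  \<open>Stirling\<close> (the first kind is \<open>stirling\<close>).\<close>

definition fact_Stirling :: "nat \<Rightarrow> int \<Rightarrow> real"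
  where "fact_Stirling n j =
    (if j < 0 then 0 else fact (nat j) * real (Stirling n (nat j)))"

definition std_x :: "nat \<Rightarrow> int \<Rightarrow> real"
  where "std_x n j = (real_of_int j - mean_a n) / sqrt (var_b n)"

end

theory Submission
  imports
    Defs
    "HOL-Complex_Analysis.Complex_Analysis"
    "HOL-Probability.Characteristic_Functions"
    "HOL-Real_Asymp.Real_Asymp"
begin

text \<open>
  The idea is to read \<open>p\<^sub>j = 2 j! S(n,j) (ln 2)\<^sup>n\<^sup>+\<^sup>1 / n!\<close> as a lattice distribution (of total
  mass tending to 1), to determine its characteristic function up to an exponentially small error
  by singularity analysis, and to invert the Fourier transform.

  The polynomial \<open>F\<^sub>n(u) = \<Sum>\<^sub>j j! S(n,j) u\<^sup>j\<close> is the \<open>n\<close>-th derivative at 0 of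
  \<open>1 / (1 - u (e\<^sup>z - 1))\<close> (\<open>higher_deriv_geometric_egf\<close>), so its size is governed by the pole that
  is nearest to 0. For \<open>u = e\<^sup>i\<^sup>\<theta>\<close> with \<open>\<bar>\<theta>\<bar> \<le> 1\<close> this is \<open>\<rho> = Ln (1 + e\<^sup>-\<^sup>i\<^sup>\<theta>)\<close>, and what remains after
  its contribution \<open>1 / ((1 + u) \<rho>\<^sup>n\<^sup>+\<^sup>1)\<close> is split off is bounded
  (\<open>geometric_poly_dominant_term\<close>), which is negligible against \<open>(ln 2)\<^sup>-\<^sup>n\<close>. For \<open>\<theta>\<close> bounded away
  from 0 there is no pole in the disc of radius \<open>ln 2\<close>, hence none in a slightly larger one, and
  \<open>F\<^sub>n(u) / n!\<close> is exponentially smaller than \<open>(ln 2)\<^sup>-\<^sup>n\<close> (\<open>geometric_poly_away_from_one\<close>).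

  After multiplication by \<open>2 (ln 2)\<^sup>n\<^sup>+\<^sup>1\<close>, the logarithm of the dominant term is
  \<open>ln 2 - Ln (1 + u) + (n + 1) (ln (ln 2) - Ln \<rho>)\<close>. Its Taylor expansion in \<open>i\<theta>\<close> has
  the coefficients \<open>a\<^sub>n\<close>, \<open>b\<^sub>n / 2\<close> and \<open>c\<^sub>n b\<^sub>n\<^sup>3\<^sup>/\<^sup>2 / (6 \<surd>n)\<close> and a remainder \<open>O(n \<theta>\<^sup>4)\<close>
  (\<open>dominant_term_expansion\<close>). The asserted density is the Fourier transform of
  \<open>exp (-t\<^sup>2/2)\<close> times a cubic correction, where \<open>t = \<surd>b\<^sub>n \<theta>\<close>
  (\<open>edgeworth_density_fourier\<close>). Both sides of the theorem are therefore Fourier integrals with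
  the same unimodular kernel, and \<open>j\<close> occurs only in that kernel: the \<open>L\<^sup>1\<close> distance of the
  two characteristic functions bounds the error for all \<open>j\<close> at once. By \<open>centred_char_bound\<close>
  this distance is \<open>O(n\<^sup>-\<^sup>3\<^sup>/\<^sup>2)\<close>, so that the error is \<open>O(\<surd>b\<^sub>n n\<^sup>-\<^sup>3\<^sup>/\<^sup>2) = O(1/n)\<close>.
\<close>

section \<open>Geometric polynomials near \<open>u = 1\<close>\<close>

lemma higher_deriv_eqI:
  fixes F :: "nat \<Rightarrow> complex \<Rightarrow> complex"
  assumes S: "open S" and z: "z \<in> S"
    and F: "\<And>n w. w \<in> S \<Longrightarrow> (F n has_field_derivative F (Suc n) w) (at w)"
  shows "(deriv ^^ n) (F 0) z = F n z"
  using z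
proof (induction n arbitrary: z)
  case (Suc n)
  have "eventually (\<lambda>w. (deriv ^^ n) (F 0) w = F n w) (nhds z)"
    using S Suc eventually_nhds by blast
  then have "deriv ((deriv ^^ n) (F 0)) z = deriv (F n) z"
    by (intro deriv_cong_ev) auto
  also have "\<dots> = F (Suc n) z"
    using F[OF Suc.prems] by (rule DERIV_imp_deriv)
  finally show ?case by simp
qed auto

definition geometric_poly :: "nat \<Rightarrow> complex \<Rightarrow> complex"
  where "geometric_poly n u = (\<Sum>k\<le>n. of_nat (fact k * Stirling n k) * u ^ k)"

text \<open>The Stirling recurrence in the form that arises when \<open>\<Sum>\<^sub>k S(n,k) G\<^sub>k\<close> is differentiated
  and \<open>G\<^sub>k' = k G\<^sub>k + G\<^sub>k\<^sub>+\<^sub>1\<close>.\<close>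

lemma sum_Stirling_Suc:
  fixes G :: "nat \<Rightarrow> complex"
  shows "(\<Sum>k\<le>Suc n. of_nat (Stirling (Suc n) k) * G k) =
         (\<Sum>k\<le>n. of_nat (Stirling n k) * (of_nat k * G k + G (Suc k)))"
proof -
  have "(\<Sum>k\<le>Suc n. of_nat (Stirling (Suc n) k) * G k) =
        (\<Sum>k\<le>n. of_nat (Suc k * Stirling n (Suc k)) * G (Suc k)) +
        (\<Sum>k\<le>n. of_nat (Stirling n k) * G (Suc k))"
    by (subst sum.atMost_Suc_shift) (simp add: sum.distrib[symmetric] algebra_simps)
  also have "(\<Sum>k\<le>n. of_nat (Suc k * Stirling n (Suc k)) * G (Suc k)) =
             (\<Sum>k\<le>Suc n. of_nat (k * Stirling n k) * G k)"
    by (subst sum.atMost_Suc_shift) simp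
  also have "\<dots> = (\<Sum>k\<le>n. of_nat (k * Stirling n k) * G k)"
    by simp
  finally show ?thesis
    by (simp add: sum.distrib[symmetric] algebra_simps)
qed

text \<open>The functions \<open>G\<^sub>k(z) = k! (u e\<^sup>z)\<^sup>k / (1 - u (e\<^sup>z - 1))\<^sup>k\<^sup>+\<^sup>1\<close> satisfy
  \<open>G\<^sub>k' = k G\<^sub>k + G\<^sub>k\<^sub>+\<^sub>1\<close>, which is the Stirling recurrence. The function to be differentiated is
  \<open>G\<^sub>0\<close>, and \<open>G\<^sub>k(0) = k! u\<^sup>k\<close>.\<close>

lemma higher_deriv_geometric_egf:
  fixes u :: complex
  assumes S: "open S" "0 \<in> S" and nz: "\<And>z. z \<in> S \<Longrightarrow> 1 - u * (exp z - 1) \<noteq> 0"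
  shows "(deriv ^^ n) (\<lambda>z. 1 / (1 - u * (exp z - 1))) 0 = geometric_poly n u"
proof -
  define G where "G = (\<lambda>k z. fact k * (u * exp z) ^ k / (1 - u * (exp z - 1)) ^ Suc k)"
  define F where "F = (\<lambda>n z. \<Sum>k\<le>n. of_nat (Stirling n k) * G k z)"
  have G: "(G k has_field_derivative of_nat k * G k z + G (Suc k) z) (at z)" if "z \<in> S" for k z
  proof -
    define y where "y = 1 - u * (exp z - 1)"
    have y: "y \<noteq> 0" using nz[OF that] by (simp add: y_def)
    have "(G k has_field_derivative
        fact k * ((of_nat k * (u * exp z) ^ (k - 1) * (u * exp z)) * y ^ Suc k
        - (u * exp z) ^ k * (of_nat (Suc k) * y ^ k * (- (u * exp z)))) / (y ^ Suc k * y ^ Suc k)) (at z)"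
      unfolding G_def y_def
      apply (rule derivative_eq_intros refl)+
      using y apply (simp add: y_def)
      apply (simp add: algebra_simps)
      done
    moreover have "fact k * ((of_nat k * (u * exp z) ^ (k - 1) * (u * exp z)) * y ^ Suc k
        - (u * exp z) ^ k * (of_nat (Suc k) * y ^ k * (- (u * exp z)))) / (y ^ Suc k * y ^ Suc k)
        = of_nat k * G k z + G (Suc k) z"
      unfolding G_def y_def[symmetric] using y
      by (cases k) (simp_all add: field_simps)
    ultimately show ?thesis by simp
  qed
  have "(F n has_field_derivative F (Suc n) z) (at z)" if "z \<in> S" for n z
    unfolding F_def sum_Stirling_Suc
    by (rule derivative_eq_intros G[OF that] refl)+ (simp add: mult_ac)
  from higher_deriv_eqI[of S 0 F, OF S this] have "(deriv ^^ n) (F 0) 0 = F n 0" .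
  moreover have "F 0 = (\<lambda>z. 1 / (1 - u * (exp z - 1)))"
    by (simp add: F_def G_def)
  moreover have "F n 0 = geometric_poly n u"
    by (simp add: F_def G_def geometric_poly_def mult_ac)
  ultimately show ?thesis by simp
qed

lemma higher_deriv_simple_pole:
  fixes \<rho> c :: complex
  assumes "\<rho> \<noteq> 0"
  shows "(deriv ^^ n) (\<lambda>z. c / (\<rho> - z)) 0 = c * fact n / \<rho> ^ Suc n"
proof -
  define F where "F = (\<lambda>n z. c * fact n / (\<rho> - z) ^ Suc n)"
  have "(F n has_field_derivative F (Suc n) z) (at z)" if "z \<in> - {\<rho>}" for n z
  proof -
    define y where "y = \<rho> - z"
    have y: "y \<noteq> 0" using that by (simp add: y_def)
    have "(F n has_field_derivative c * fact n * (of_nat (Suc n) * y ^ n) / (y ^ Suc n * y ^ Suc n)) (at z)"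
      unfolding F_def y_def
      apply (rule derivative_eq_intros refl)+
      using y apply (simp add: y_def)
      apply (simp add: algebra_simps)
      done
    moreover have "c * fact n * (of_nat (Suc n) * y ^ n) / (y ^ Suc n * y ^ Suc n) = F (Suc n) z"
      unfolding F_def y_def[symmetric] using y by (simp add: field_simps)
    ultimately show ?thesis by simp
  qed
  from higher_deriv_eqI[of "-{\<rho>}" 0 F, OF _ _ this] assms show ?thesis
    by (simp add: F_def open_Compl)
qed

text \<open>The function \<open>1 / (1 - e\<^sup>w)\<close> has its poles in \<open>2\<pi>i\<int>\<close>; the radius 6 is a convenient value
  below \<open>2\<pi>\<close>. The regular part at 0 is found by two removable singularities: first
  \<open>q(w) = (e\<^sup>w - 1) / w\<close>, which does not vanish in the disc, and then \<open>(1 / q(w) - 1) / w\<close>.\<close>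

lemma inverse_exp_minus_one_regular_part:
  obtains g where "g holomorphic_on ball (0::complex) 6"
    "\<And>w. w \<in> ball 0 6 \<Longrightarrow> w \<noteq> 0 \<Longrightarrow> 1 / (1 - exp w) = g w - 1 / w"
proof -
  define q where "q = (\<lambda>w::complex. if w = 0 then 1 else (exp w - 1) / w)"
  have "(\<lambda>z::complex. if z = 0 then deriv exp 0 else (exp z - exp 0)/(z-0)) holomorphic_on UNIV"
    by (intro pole_lemma_open holomorphic_intros open_UNIV)
  also have "(\<lambda>z::complex. if z = 0 then deriv exp 0 else (exp z - exp 0)/(z-0)) = q"
    using DERIV_exp[of "0::complex"] by (auto simp: q_def fun_eq_iff DERIV_imp_deriv)
  finally have q: "q holomorphic_on UNIV" .
  have q_nz: "q w \<noteq> 0" if "w \<in> ball 0 6" for w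
  proof
    assume "q w = 0"
    then have "w \<noteq> 0" "exp w = 1" by (auto simp: q_def split: if_splits)
    then obtain n where "Re w = 0" "Im w = of_int (2 * n) * pi"
      by (auto simp: exp_eq_1)
    moreover have "n \<noteq> 0" using \<open>w \<noteq> 0\<close> calculation by (auto simp: complex_eq_iff)
    ultimately have "\<bar>Im w\<bar> \<ge> 2 * pi" by (auto simp: abs_mult)
    moreover have "\<bar>Im w\<bar> < 6" using that abs_Im_le_cmod[of w] by auto
    ultimately show False using pi_gt3 by linarith
  qed
  define g where "g = (\<lambda>w. - (if w = 0 then deriv (\<lambda>w. 1 / q w) 0
                        else (1 / q w - 1 / q 0) / (w - 0)))"
  have "(\<lambda>w. 1 / q w) holomorphic_on ball 0 6"
    using q_nz by (intro holomorphic_intros holomorphic_on_subset[OF q]) auto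
  then have "g holomorphic_on ball 0 6"
    unfolding g_def by (intro holomorphic_on_minus pole_lemma_open) auto
  moreover have "1 / (1 - exp w) = g w - 1 / w" if "w \<in> ball 0 6" "w \<noteq> 0" for w
  proof -
    have "exp w \<noteq> 1" using q_nz[OF that(1)] that(2) by (auto simp: q_def)
    then show ?thesis using that by (simp add: g_def q_def field_simps)
  qed
  ultimately show ?thesis using that by blast
qed

lemma Re_inverse_cis_pos:
  assumes "\<bar>\<theta>\<bar> \<le> 1" shows "Re (exp (- (\<i> * of_real \<theta>))) > 0"
proof -
  have "cos \<theta> > 0" using assms pi_gt3 by (intro cos_gt_zero_pi) auto
  then show ?thesis by (simp add: Re_exp)
qed

text \<open>For \<open>\<bar>\<theta>\<bar> \<le> 1\<close>, the solution \<open>z\<close> of \<open>u (e\<^sup>z - 1) = 1\<close> that is nearest to 0, where \<open>u = e\<^sup>i\<^sup>\<theta>\<close>.\<close>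

definition dominant_pole :: "real \<Rightarrow> complex"
  where "dominant_pole \<theta> = Ln (1 + exp (- (\<i> * of_real \<theta>)))"

lemma exp_dominant_pole:
  assumes "\<bar>\<theta>\<bar> \<le> 1" shows "exp (dominant_pole \<theta>) = 1 + exp (- (\<i> * of_real \<theta>))"
proof -
  have "1 + exp (- (\<i> * of_real \<theta>)) \<noteq> 0"
    using Re_inverse_cis_pos[OF assms] by (auto simp: complex_eq_iff)
  then show ?thesis unfolding dominant_pole_def by simp
qed

lemma dominant_pole_nonzero:
  assumes "\<bar>\<theta>\<bar> \<le> 1" shows "dominant_pole \<theta> \<noteq> 0"
  using exp_dominant_pole[OF assms] by auto

text \<open>The crude bound 3 ensures that \<open>z - \<rho>\<close> stays in the disc of radius 6, where the regular part
  of \<open>1 / (1 - e\<^sup>w)\<close> is available, while \<open>z\<close> runs through a disc that is larger than the unit disc.\<close>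

lemma norm_dominant_pole_le:
  assumes "\<bar>\<theta>\<bar> \<le> 1" shows "norm (dominant_pole \<theta>) \<le> 3"
proof -
  let ?w = "1 + exp (- (\<i> * of_real \<theta>))"
  have "Re ?w > 1" using Re_inverse_cis_pos[OF assms] by simp
  then have w0: "?w \<noteq> 0" by (auto simp: complex_eq_iff)
  have "norm ?w \<le> 2" 
    by (rule order_trans[OF norm_triangle_ineq]) simp
  moreover have "norm ?w > 1" using \<open>Re ?w > 1\<close> complex_Re_le_cmod[of ?w] by linarith
  ultimately have "\<bar>ln (norm ?w)\<bar> \<le> 1"
    using ln_le_minus_one[of "norm ?w"] ln_ge_zero[of "norm ?w"] by linarith
  moreover have "\<bar>Im (Ln ?w)\<bar> \<le> 2"
    using Re_Ln_pos_lt[OF w0] \<open>Re ?w > 1\<close> pi_less_4 by linarith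
  ultimately show ?thesis
    using cmod_le[of "Ln ?w"] w0 unfolding dominant_pole_def by (simp add: Re_Ln)
qed

text \<open>Because \<open>u e\<^sup>\<rho> = 1 + u\<close>, the denominator \<open>1 - u (e\<^sup>z - 1)\<close> factors as
  \<open>(1 + u) (1 - e\<^sup>z\<^sup>-\<^sup>\<rho>)\<close>. Hence the generating function minus its principal part at \<open>\<rho>\<close> is
  \<open>g(z - \<rho>) / (1 + u)\<close> with one fixed function \<open>g\<close>, which is bounded on the unit circle uniformly
  in \<open>\<theta>\<close>. Cauchy's inequality with radius 1 gives an error that does not grow with \<open>n\<close>.\<close>

lemma geometric_poly_dominant_term:
  obtains C where "C > 0"
    "\<And>n \<theta>. \<bar>\<theta>\<bar> \<le> 1 \<Longrightarrow> norm (geometric_poly n (exp (\<i> * of_real \<theta>)) / fact n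
        - 1 / ((1 + exp (\<i> * of_real \<theta>)) * dominant_pole \<theta> ^ Suc n)) \<le> C"
proof -
  obtain g where g: "g holomorphic_on ball (0::complex) 6"
    and g_eq: "\<And>w. w \<in> ball 0 6 \<Longrightarrow> w \<noteq> 0 \<Longrightarrow> 1 / (1 - exp w) = g w - 1 / w"
    using inverse_exp_minus_one_regular_part by blast
  have "continuous_on (cball 0 5) g"
    using g by (intro holomorphic_on_imp_continuous_on holomorphic_on_subset[OF g]) auto
  then have "bounded (g ` cball 0 5)"
    by (intro compact_imp_bounded compact_continuous_image) auto
  then obtain C where C: "C > 0" "\<And>w. w \<in> cball 0 5 \<Longrightarrow> norm (g w) \<le> C"
    unfolding bounded_pos by auto
  have "norm (geometric_poly n (exp (\<i> * of_real \<theta>)) / fact n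
        - 1 / ((1 + exp (\<i> * of_real \<theta>)) * dominant_pole \<theta> ^ Suc n)) \<le> C"
    if \<theta>: "\<bar>\<theta>\<bar> \<le> 1" for n \<theta>
  proof -
    define u where "u = exp (\<i> * of_real \<theta>)"
    define \<rho> where "\<rho> = dominant_pole \<theta>"
    have \<rho>0: "\<rho> \<noteq> 0" and \<rho>3: "norm \<rho> \<le> 3"
      using dominant_pole_nonzero[OF \<theta>] norm_dominant_pole_le[OF \<theta>] by (auto simp: \<rho>_def)
    have u_inv: "exp (- (\<i> * of_real \<theta>)) = 1 / u"
      by (simp add: u_def exp_minus divide_inverse)
    have "exp \<rho> = 1 + 1 / u"
      unfolding \<rho>_def exp_dominant_pole[OF \<theta>] u_inv ..
    then have ue: "u * exp \<rho> = 1 + u"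
      by (simp add: u_def field_simps)
    have "Re u > 0" using Re_inverse_cis_pos[of "-\<theta>"] \<theta> by (simp add: u_def)
    then have u1: "norm (1 + u) \<ge> 1"
      using complex_Re_le_cmod[of "1+u"] by simp
    then have u1': "1 + u \<noteq> 0" by auto
    have denom: "1 - u * (exp z - 1) = (1 + u) * (1 - exp (z - \<rho>))" for z
    proof -
      have "u * exp z = (1 + u) * exp (z - \<rho>)"
        unfolding ue[symmetric] by (simp add: exp_diff)
      then show ?thesis by (simp add: algebra_simps)
    qed
    define h where "h = (\<lambda>z. g (z - \<rho>) / (1 + u))"
    have in_ball: "z - \<rho> \<in> ball 0 6" if "norm z < 3" for z
      using norm_triangle_ineq4[of z \<rho>] \<rho>3 that by auto
    \<comment> \<open>Near 0 the generating function and its principal part are both holomorphic, so that the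
      derivatives of \<open>h\<close> at 0 split accordingly; on the larger disc only \<open>h\<close> itself is holomorphic.\<close>
    define S where "S = ball (0::complex) (min 1 (norm \<rho>))"
    have S: "open S" "0 \<in> S" using \<rho>0 by (auto simp: S_def)
    have S_nz: "1 - u * (exp z - 1) \<noteq> 0" and
         h_eq: "h z = 1 / (1 - u * (exp z - 1)) - (1 / (1 + u)) / (\<rho> - z)" if "z \<in> S" for z
    proof -
      have z: "norm z < 1" "z \<noteq> \<rho>" using that by (auto simp: S_def)
      then have ge: "1 / (1 - exp (z - \<rho>)) = g (z - \<rho>) - 1 / (z - \<rho>)"
        by (intro g_eq in_ball) auto
      show "1 - u * (exp z - 1) \<noteq> 0"
      proof
        assume "1 - u * (exp z - 1) = 0"
        then have "exp (z - \<rho>) = 1" using u1' by (simp add: denom)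
        then obtain m where m: "Re (z - \<rho>) = 0" "Im (z - \<rho>) = of_int (2 * m) * pi"
          by (auto simp: exp_eq_1)
        then have "m \<noteq> 0" using z by (auto simp: complex_eq_iff)
        then have "\<bar>Im (z - \<rho>)\<bar> \<ge> 2 * pi" using m by (auto simp: abs_mult)
        moreover have "\<bar>Im (z - \<rho>)\<bar> < 6"
          using abs_Im_le_cmod[of "z - \<rho>"] in_ball[of z] z by auto
        ultimately show False using pi_gt3 by linarith
      qed
      show "h z = 1 / (1 - u * (exp z - 1)) - (1 / (1 + u)) / (\<rho> - z)"
      proof -
        have "1 / (1 - u * (exp z - 1)) = (1 / (1 + u)) * (1 / (1 - exp (z - \<rho>)))"
          by (simp add: denom)
        also have "\<dots> = h z + (1 / (1 + u)) / (\<rho> - z)"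
        proof -
          have "1 / (\<rho> - z) = - (1 / (z - \<rho>))"
            by (metis minus_diff_eq minus_divide_right)
          then have "(1 / (1 + u)) / (\<rho> - z) = - ((1 / (1 + u)) * (1 / (z - \<rho>)))"
            by (metis mult_minus_right times_divide_eq_right mult.right_neutral)
          then show ?thesis unfolding ge h_def by (simp add: right_diff_distrib)
        qed
        finally show ?thesis by simp
      qed
    qed
    have hol_h: "h holomorphic_on ball 0 2"
    proof -
      have "(g \<circ> (\<lambda>z. z - \<rho>)) holomorphic_on ball 0 2"
        using in_ball by (intro holomorphic_on_compose_gen[OF _ g] holomorphic_intros) auto
      then show ?thesis unfolding h_def using u1' by (intro holomorphic_intros) (auto simp: o_def)
    qed
    have "norm ((deriv ^^ n) h 0) \<le> fact n * C / 1 ^ n"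
    proof (rule Cauchy_inequality)
      show "h holomorphic_on ball 0 1" by (rule holomorphic_on_subset[OF hol_h]) auto
      show "continuous_on (cball 0 1) h"
        by (intro holomorphic_on_imp_continuous_on holomorphic_on_subset[OF hol_h]) auto
      fix x :: complex assume "norm (0 - x) = 1"
      then have "norm (x - \<rho>) \<le> 5" using norm_triangle_ineq4[of x \<rho>] \<rho>3 by simp
      then have "norm (g (x - \<rho>)) \<le> C" by (intro C) auto
      then show "norm (h x) \<le> C"
        unfolding h_def norm_divide using u1 C(1)
        by (metis div_by_1 frac_le less_eq_real_def norm_ge_zero zero_less_one)
    qed auto
    also have "(deriv ^^ n) h 0 = (deriv ^^ n) (\<lambda>z. 1 / (1 - u * (exp z - 1)) - (1 / (1 + u)) / (\<rho> - z)) 0"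
    proof (rule higher_deriv_transform_within_open[where S=S])
      show "h holomorphic_on S" by (rule holomorphic_on_subset[OF hol_h]) (auto simp: S_def)
      then show "(\<lambda>z. 1 / (1 - u * (exp z - 1)) - (1 / (1 + u)) / (\<rho> - z)) holomorphic_on S"
        by (rule holomorphic_transform) (fact h_eq)
    qed (fact S h_eq)+
    also have "\<dots> = (deriv ^^ n) (\<lambda>z. 1 / (1 - u * (exp z - 1))) 0 - (deriv ^^ n) (\<lambda>z. (1 / (1 + u)) / (\<rho> - z)) 0"
      by (intro higher_deriv_diff[where S=S] holomorphic_intros) (use S S_nz in \<open>auto simp: S_def\<close>)
    also have "\<dots> = geometric_poly n u - (1 / (1 + u)) * fact n / \<rho> ^ Suc n"
      using higher_deriv_geometric_egf[OF S, of u] S_nz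
        higher_deriv_simple_pole[OF \<rho>0, of n "1 / (1 + u)"] by simp
    also have "\<dots> = fact n * (geometric_poly n u / fact n - 1 / ((1 + u) * \<rho> ^ Suc n))"
      by (simp add: field_simps)
    finally show ?thesis unfolding u_def \<rho>_def by (simp add: norm_mult)
  qed
  with C(1) that show ?thesis by blast
qed

section \<open>Geometric polynomials away from \<open>u = 1\<close>\<close>

lemma norm_exp_minus_one_le:
  fixes z :: complex shows "norm (exp z - 1) \<le> exp (norm z) - 1"
proof -
  let ?f = "\<lambda>n. inverse (fact (Suc n)) *\<^sub>R z ^ Suc n"
  let ?g = "\<lambda>n. inverse (fact (Suc n)) *\<^sub>R norm z ^ Suc n"
  have g: "summable ?g"
    using summable_exp_generic[of "norm z"] by (subst summable_Suc_iff) (simp add: divide_inverse)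
  have "exp z - 1 = (\<Sum>n. ?f n)" by (subst exp_first_term) simp
  also have "norm \<dots> \<le> (\<Sum>n. norm (?f n))"
    by (intro summable_norm) (use g in \<open>simp add: norm_mult norm_power norm_inverse\<close>)
  also have "\<dots> = (\<Sum>n. ?g n)" by (simp add: norm_mult norm_power norm_inverse)
  also have "\<dots> = exp (norm z) - 1" by (subst exp_first_term) simp
  finally show ?thesis .
qed

text \<open>In \<open>e\<^sup>z - 1 = (e\<^sup>z\<^sup>/\<^sup>2 - 1) (e\<^sup>z\<^sup>/\<^sup>2 + 1)\<close> the second factor already has a strictly smaller norm
  than \<open>e\<^sup>\<bar>\<^sup>z\<^sup>\<bar>\<^sup>/\<^sup>2 + 1\<close>, because the norm of \<open>e\<^sup>z\<^sup>/\<^sup>2\<close> depends on the real part of \<open>z\<close> only.\<close>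

lemma norm_exp_minus_one_less:
  fixes z :: complex assumes "Re z < norm z"
  shows "norm (exp z - 1) < exp (norm z) - 1"
proof -
  define w where "w = z / 2"
  have w: "Re w < norm w" "norm z = norm w + norm w" "w \<noteq> 0"
    using assms by (auto simp: w_def norm_divide)
  have "exp z = exp w * exp w" by (simp add: w_def flip: exp_add)
  then have "exp z - 1 = (exp w - 1) * (exp w + 1)" by (simp add: algebra_simps)
  then have "norm (exp z - 1) = norm (exp w - 1) * norm (exp w + 1)" by (simp add: norm_mult)
  also have "\<dots> \<le> (exp (norm w) - 1) * norm (exp w + 1)"
    by (intro mult_right_mono norm_exp_minus_one_le) auto
  also have "\<dots> < (exp (norm w) - 1) * (exp (norm w) + 1)"
  proof (rule mult_strict_left_mono)
    have "norm (exp w + 1) \<le> exp (Re w) + 1"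
      by (rule order_trans[OF norm_triangle_ineq]) (simp add: norm_exp_eq_Re)
    also have "\<dots> < exp (norm w) + 1" using w by simp
    finally show "norm (exp w + 1) < exp (norm w) + 1" .
  qed (use w in auto)
  also have "\<dots> = exp (norm z) - 1"
    unfolding w(2) exp_add by (simp add: algebra_simps del: mult_exp_exp)
  finally show ?thesis .
qed

text \<open>A zero would require \<open>\<bar>e\<^sup>z - 1\<bar> = 1\<close>. As \<open>\<bar>e\<^sup>z - 1\<bar> \<le> e\<^sup>\<bar>\<^sup>z\<^sup>\<bar> - 1 \<le> 1\<close>, equality must hold, which
  forces \<open>z\<close> to be real and \<open>e\<^sup>z = 2\<close>, and then \<open>u = 1\<close>.\<close>

lemma geometric_egf_denominator_nonzero:
  fixes z :: complex
  assumes u: "norm u = 1" "u \<noteq> 1" and z: "norm z \<le> ln 2"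
  shows "1 - u * (exp z - 1) \<noteq> 0"
proof
  assume "1 - u * (exp z - 1) = 0"
  then have eq: "u * (exp z - 1) = 1" by simp
  then have n1: "norm (exp z - 1) = 1"
    using u by (metis norm_mult norm_one mult_1)
  have "exp (norm z) \<le> 2"
    using z by (metis exp_le_cancel_iff exp_ln zero_less_numeral)
  then have "\<not> Re z < norm z" using norm_exp_minus_one_less[of z] n1 by auto
  then have "Re z = norm z" using complex_Re_le_cmod[of z] by simp
  then have "z = of_real (norm z)"
    using cmod_power2[of z] by (auto simp: complex_eq_iff)
  then obtain x where x: "z = of_real x" "x \<ge> 0" by (metis norm_ge_zero)
  then have "exp z - 1 = of_real (exp x - 1)" by (simp add: exp_of_real)
  moreover from this n1 x have "exp x - 1 = 1"
    by (metis norm_of_real abs_of_nonneg diff_ge_0_iff_ge one_le_exp_iff)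
  ultimately have "exp z - 1 = 1" by simp
  with eq u show False by simp
qed

lemma iexp_neq_1:
  assumes "\<theta> \<noteq> 0" "\<bar>\<theta>\<bar> \<le> pi" shows "exp (\<i> * of_real \<theta>) \<noteq> 1"
proof
  assume "exp (\<i> * of_real \<theta>) = 1"
  then obtain n where n: "\<theta> = of_int (2 * n) * pi" by (auto simp: exp_eq_1)
  with assms have "n \<noteq> 0" by auto
  then have "\<bar>\<theta>\<bar> \<ge> 2 * pi" using n by (auto simp: abs_mult)
  with assms show False using pi_gt3 by linarith
qed

text \<open>The denominator has no zero on the compact set of all \<open>(\<theta>, z)\<close> with \<open>\<delta> \<le> \<bar>\<theta>\<bar> \<le> \<pi>\<close> and
  \<open>\<bar>z\<bar> \<le> ln 2\<close>. By uniform continuity it stays away from 0 on a disc of some radius \<open>R > ln 2\<close>, and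
  Cauchy's inequality with radius \<open>R\<close> gains an exponential factor over \<open>(ln 2)\<^sup>-\<^sup>n\<close>.\<close>

lemma geometric_poly_away_from_one:
  assumes \<delta>: "\<delta> > 0"
  obtains C R where "C > 0" "R > ln 2"
    "\<And>n \<theta>. \<delta> \<le> \<bar>\<theta>\<bar> \<Longrightarrow> \<bar>\<theta>\<bar> \<le> pi \<Longrightarrow>
        norm (geometric_poly n (exp (\<i> * of_real \<theta>)) / fact n) \<le> C / R ^ n"
proof -
  define K where "K = {-pi..-\<delta>} \<union> {\<delta>..pi}"
  have K: "\<theta> \<in> K \<longleftrightarrow> \<delta> \<le> \<bar>\<theta>\<bar> \<and> \<bar>\<theta>\<bar> \<le> pi" for \<theta>
    using \<delta> by (auto simp: K_def)
  define D where "D = (\<lambda>p. norm (1 - exp (\<i> * of_real (fst p)) * (exp (snd p :: complex) - 1)))"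
  have contD: "continuous_on A D" for A
    unfolding D_def by (intro continuous_intros)
  have compK: "compact (K \<times> cball (0::complex) r)" for r
    unfolding K_def by (intro compact_Times) auto
  have "\<exists>m>0. \<forall>p\<in>K \<times> cball 0 (ln 2). m \<le> D p"
  proof (cases "K = {}")
    case False
    then have "K \<times> cball (0::complex) (ln 2) \<noteq> {}" by auto
    from continuous_attains_inf[OF compK this contD]
    obtain p where p: "p \<in> K \<times> cball 0 (ln 2)" "\<forall>q \<in> K \<times> cball 0 (ln 2). D p \<le> D q"
      by (elim bexE)
    have p1: "fst p \<in> K" "norm (snd p) \<le> ln 2" using p(1) by auto
    then have "exp (\<i> * of_real (fst p)) \<noteq> 1" using K[of "fst p"] \<delta> by (intro iexp_neq_1) auto
    then have "1 - exp (\<i> * of_real (fst p)) * (exp (snd p) - 1) \<noteq> 0"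
      using p1 by (intro geometric_egf_denominator_nonzero) auto
    then have "D p > 0" unfolding D_def by simp
    with p(2) show ?thesis by (intro exI[of _ "D p"]) simp
  qed (auto intro: exI[of _ 1])
  then obtain m where m: "m > 0" "\<forall>p \<in> K \<times> cball 0 (ln 2). m \<le> D p" by (elim exE conjE)
  have "uniformly_continuous_on (K \<times> cball 0 1) D"
    by (intro compact_uniformly_continuous contD compK)
  then obtain d where d: "d > 0" "\<forall>p \<in> K \<times> cball 0 1. \<forall>q \<in> K \<times> cball 0 1.
      dist q p < d \<longrightarrow> dist (D q) (D p) < m / 2"
    unfolding uniformly_continuous_on_def using half_gt_zero[OF m(1)] by meson
  define R where "R = min 1 (ln 2 + d / 2)"
  have R: "R > ln 2" "R \<le> 1" "R - ln 2 < d" using d(1) ln_2_less_1 by (auto simp: R_def)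
  have R0: "R > 0" using R(1) ln_gt_zero[of "2::real"] by linarith
  have low: "m / 2 \<le> D (\<theta>, z)" if \<theta>: "\<theta> \<in> K" and z: "norm z \<le> R" for \<theta> z
  proof -
    \<comment> \<open>The point \<open>z\<close> is compared with its contraction into the disc of radius \<open>ln 2\<close>.\<close>
    define z' where "z' = of_real (ln 2 / R) * z"
    have n': "norm z' = ln 2 / R * norm z" using R0 by (simp add: z'_def norm_mult norm_divide)
    also have "\<dots> \<le> ln 2 / R * R" using z R0 by (intro mult_left_mono) auto
    finally have z': "norm z' \<le> ln 2" using R0 by simp
    have "z - z' = of_real (1 - ln 2 / R) * z" by (simp add: z'_def algebra_simps)
    then have "norm (z - z') = (1 - ln 2 / R) * norm z"
      using R R0 by (simp add: norm_mult del: of_real_diff)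
    also have "\<dots> \<le> (1 - ln 2 / R) * R" using z R R0 by (intro mult_left_mono) auto
    also have "\<dots> = R - ln 2" using R0 by (simp add: field_simps)
    finally have "dist (\<theta>, z) (\<theta>, z') < d" using R by (simp add: dist_prod_def dist_norm)
    then have "dist (D (\<theta>, z)) (D (\<theta>, z')) < m / 2"
      using \<theta> z z' R by (intro d(2)[rule_format]) auto
    moreover have "m \<le> D (\<theta>, z')" using \<theta> z' by (intro m(2)[rule_format]) auto
    ultimately show ?thesis unfolding dist_real_def by argo
  qed
  have "norm (geometric_poly n (exp (\<i> * of_real \<theta>)) / fact n) \<le> (2 / m) / R ^ n"
    if "\<delta> \<le> \<bar>\<theta>\<bar>" "\<bar>\<theta>\<bar> \<le> pi" for n \<theta>
  proof -
    define u where "u = exp (\<i> * of_real \<theta>)"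
    define f where "f = (\<lambda>z. 1 / (1 - u * (exp z - 1)))"
    have low': "m / 2 \<le> norm (1 - u * (exp z - 1))" if "norm z \<le> R" for z
      using low[of \<theta> z] \<open>\<delta> \<le> \<bar>\<theta>\<bar>\<close> \<open>\<bar>\<theta>\<bar> \<le> pi\<close> that by (simp add: K D_def u_def)
    then have nz: "1 - u * (exp z - 1) \<noteq> 0" if "norm z \<le> R" for z
      using that m(1) by (metis half_gt_zero norm_zero not_le)
    have "norm ((deriv ^^ n) f 0) \<le> fact n * (2 / m) / R ^ n"
    proof (rule Cauchy_inequality)
      show "f holomorphic_on ball 0 R" unfolding f_def
        using nz by (intro holomorphic_intros) auto
      show "continuous_on (cball 0 R) f" unfolding f_def
        using nz by (intro continuous_intros) auto
      fix x :: complex assume "norm (0 - x) = R"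
      then have "m / 2 \<le> norm (1 - u * (exp x - 1))" by (intro low') auto
      then have "1 / norm (1 - u * (exp x - 1)) \<le> 1 / (m / 2)"
        using m(1) by (intro frac_le) auto
      then show "norm (f x) \<le> 2 / m"
        unfolding f_def norm_divide by simp
    qed (fact R0)
    also have "(deriv ^^ n) f 0 = geometric_poly n u"
      unfolding f_def using R0 nz by (intro higher_deriv_geometric_egf[of "ball 0 R"]) auto
    finally show ?thesis by (simp add: u_def norm_divide field_simps)
  qed
  then show ?thesis using that[of "2 / m" R] m(1) R(1) by auto
qed

section \<open>Cumulant expansion of the dominant term\<close>

lemma holomorphic_Taylor3:
  fixes f f1 f2 f3 :: "complex \<Rightarrow> complex"
  assumes f: "\<And>z. norm z < 1 \<Longrightarrow> (f has_field_derivative f1 z) (at z)"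
    and f1: "\<And>z. norm z < 1 \<Longrightarrow> (f1 has_field_derivative f2 z) (at z)"
    and f2: "\<And>z. norm z < 1 \<Longrightarrow> (f2 has_field_derivative f3 z) (at z)"
  obtains B where "B > 0" "\<And>z. norm z \<le> 1/2 \<Longrightarrow>
    norm (f z - (f 0 + f1 0 * z + f2 0 * z^2 / 2 + f3 0 * z^3 / 6)) \<le> B * norm z ^ 4"
proof -
  define F where "F = (\<lambda>i::nat. if i = 0 then f else if i = 1 then f1 else if i = 2 then f2
                       else if i = 3 then f3 else deriv f3)"
  have "f2 holomorphic_on ball 0 1"
    using f2 by (force simp: holomorphic_on_open)
  then have "deriv f2 holomorphic_on ball 0 1"
    by (rule holomorphic_deriv) auto
  then have f3: "f3 holomorphic_on ball 0 1"
    by (rule holomorphic_transform) (auto intro: DERIV_imp_deriv f2)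
  then have "deriv f3 holomorphic_on ball 0 1"
    by (rule holomorphic_deriv) auto
  then have "continuous_on (cball 0 (1/2)) (deriv f3)"
    by (intro holomorphic_on_imp_continuous_on) (rule holomorphic_on_subset, auto)
  then have "bounded (deriv f3 ` cball 0 (1/2))"
    by (intro compact_imp_bounded compact_continuous_image) auto
  then obtain B where B: "B > 0" "\<And>z. z \<in> cball 0 (1/2) \<Longrightarrow> norm (deriv f3 z) \<le> B"
    unfolding bounded_pos by auto
  have f3': "(f3 has_field_derivative deriv f3 z) (at z)" if "norm z < 1" for z
    using holomorphic_derivI[OF f3, of z UNIV] that by auto
  have "norm (f z - (f 0 + f1 0 * z + f2 0 * z^2 / 2 + f3 0 * z^3 / 6)) \<le> B * norm z ^ 4"
    if z: "norm z \<le> 1/2" for z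
  proof -
    have "norm (F 0 z - (\<Sum>i\<le>3. F i 0 * (z - 0) ^ i / fact i)) \<le> B * norm (z - 0) ^ Suc 3 / fact 3"
    proof (rule complex_Taylor[where S = "cball 0 (1/2)"])
      fix i :: nat and x :: complex assume x: "x \<in> cball 0 (1/2)" and i: "i \<le> 3"
      then have "i = 0 \<or> i = 1 \<or> i = 2 \<or> i = 3" "norm x < 1" by auto
      then have "(F i has_field_derivative F (Suc i) x) (at x)"
        using f f1 f2 f3' by (auto simp: F_def)
      then show "(F i has_field_derivative F (Suc i) x) (at x within cball 0 (1/2))"
        by (rule has_field_derivative_at_within)
    qed (use B z in \<open>auto simp: F_def\<close>)
    also have "\<dots> \<le> B * norm z ^ 4"
      using mult_nonneg_nonneg[of B "norm z ^ 4"] B(1) by (simp add: fact_numeral)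
    finally show ?thesis
      by (simp add: F_def eval_nat_numeral fact_numeral algebra_simps)
  qed
  with B(1) that show ?thesis by blast
qed

lemma Re_exp_pos:
  fixes z :: complex assumes "norm z < 1" shows "Re (exp z) > 0"
proof -
  have "\<bar>Im z\<bar> < pi / 2" using abs_Im_le_cmod[of z] assms pi_gt3 by linarith
  then have "cos (Im z) > 0" by (intro cos_gt_zero_pi) auto
  then show ?thesis by (simp add: Re_exp)
qed

text \<open>With \<open>s = 1 / (1 + e\<^sup>z)\<close>, for which \<open>s' = - s (1 - s)\<close>, the third derivative is
  \<open>s (1 - s) (1 - 2 s)\<close>. It vanishes at 0 because \<open>s(0) = 1/2\<close>; this is why there is no cubic term.\<close>

lemma Taylor_Ln_one_plus_exp:
  obtains B where "B > 0" "\<And>z. norm z \<le> 1/2 \<Longrightarrow>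
    norm (- Ln (1 + exp z) - (- of_real (ln 2) - z / 2 - z\<^sup>2 / 8)) \<le> B * norm z ^ 4"
proof -
  define s where "s = (\<lambda>z::complex. 1 / (1 + exp z))"
  have nz: "1 + exp z \<noteq> 0" "1 + exp z \<notin> \<real>\<^sub>\<le>\<^sub>0" if "norm z < 1" for z :: complex
    using Re_exp_pos[OF that] by (auto simp: complex_eq_iff complex_nonpos_Reals_iff)
  have s: "(s has_field_derivative - (s z * (1 - s z))) (at z)" if "norm z < 1" for z
    unfolding s_def using nz[OF that]
    by (auto intro!: derivative_eq_intros simp: field_simps)
  have L: "((\<lambda>z. - Ln (1 + exp z)) has_field_derivative s z - 1) (at z)" if "norm z < 1" for z
    unfolding s_def using nz[OF that]
    by (auto intro!: derivative_eq_intros simp: field_simps)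
  have s1: "((\<lambda>z. s z - 1) has_field_derivative - (s z * (1 - s z))) (at z)" if "norm z < 1" for z
    by (auto intro!: derivative_eq_intros s that)
  have s2: "((\<lambda>z. - (s z * (1 - s z))) has_field_derivative s z * (1 - s z) * (1 - 2 * s z)) (at z)"
    if "norm z < 1" for z
    by (rule derivative_eq_intros s that refl)+ (simp add: algebra_simps)
  have s0: "s 0 = 1 / 2" by (simp add: s_def)
  have Ln2: "Ln 2 = of_real (ln 2)" by (metis Ln_of_real of_real_numeral zero_less_numeral)
  obtain B where "B > 0" and B: "\<And>z. norm z \<le> 1/2 \<Longrightarrow>
    norm (- Ln (1 + exp z) - (- Ln (1 + exp 0) + (s 0 - 1) * z + - (s 0 * (1 - s 0)) * z^2 / 2
      + (s 0 * (1 - s 0) * (1 - 2 * s 0)) * z^3 / 6)) \<le> B * norm z ^ 4"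
    using holomorphic_Taylor3[OF L s1 s2] by blast
  have "norm (- Ln (1 + exp z) - (- of_real (ln 2) - z / 2 - z\<^sup>2 / 8)) \<le> B * norm z ^ 4"
    if "norm z \<le> 1/2" for z
  proof -
    have "- Ln (1 + exp 0) + (s 0 - 1) * z + - (s 0 * (1 - s 0)) * z^2 / 2
      + (s 0 * (1 - s 0) * (1 - 2 * s 0)) * z^3 / 6 = - of_real (ln 2) - z / 2 - z\<^sup>2 / 8"
      by (simp add: s0 Ln2 field_simps)
    with B[OF that] show ?thesis by simp
  qed
  with \<open>B > 0\<close> that show ?thesis by blast
qed

text \<open>The inner logarithm \<open>g\<close> has the derivative \<open>- s\<close> with \<open>s = 1 / (1 + e\<^sup>z)\<close>, so all derivatives are
  polynomials in \<open>s\<close> and \<open>1 / g\<close>, evaluated at \<open>s = 1/2\<close> and \<open>g = ln 2\<close>. The resulting coefficients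
  are the rates at which the first three cumulants grow with \<open>n\<close>.\<close>

lemma Taylor_Ln_Ln_one_plus_exp:
  obtains B where "B > 0" "\<And>z. norm z \<le> 1/2 \<Longrightarrow>
    norm (- Ln (Ln (1 + exp (- z))) - (- of_real (ln (ln 2)) + of_real (1 / (2 * ln 2)) * z
      + of_real ((1 - ln 2) / (2 * ln 2)^2) * z\<^sup>2 / 2
      + of_real ((2 - 3 * ln 2) / (2 * ln 2)^3) * z^3 / 6)) \<le> B * norm z ^ 4"
proof -
  define s where "s = (\<lambda>z::complex. 1 / (1 + exp z))"
  define g where "g = (\<lambda>z::complex. Ln (1 + exp (- z)))"
  have nz: "1 + exp z \<noteq> 0" "1 + exp z \<notin> \<real>\<^sub>\<le>\<^sub>0" if "norm z < 1" for z :: complex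
    using Re_exp_pos[OF that] by (auto simp: complex_eq_iff complex_nonpos_Reals_iff)
  \<comment> \<open>The outer logarithm is holomorphic because \<open>\<bar>1 + e\<^sup>-\<^sup>z\<bar> > 1\<close> puts \<open>g\<close> into the right half-plane.\<close>
  have g_pos: "Re (g z) > 0" if "norm z < 1" for z
  proof -
    have "Re (1 + exp (- z)) > 1" using Re_exp_pos[of "- z"] that by simp
    then have "norm (1 + exp (- z)) > 1" using complex_Re_le_cmod order.strict_trans2 by blast
    then show ?thesis unfolding g_def using nz(1)[of "-z"] that by (simp add: Re_Ln)
  qed
  have gnz: "g z \<noteq> 0" "g z \<notin> \<real>\<^sub>\<le>\<^sub>0" if "norm z < 1" for z
    using g_pos[OF that] by (auto simp: complex_eq_iff complex_nonpos_Reals_iff)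
  have s: "(s has_field_derivative - (s z * (1 - s z))) (at z)" if "norm z < 1" for z
    unfolding s_def using nz[OF that]
    by (auto intro!: derivative_eq_intros simp: field_simps)
  have g: "(g has_field_derivative - s z) (at z)" if "norm z < 1" for z
  proof -
    have "exp (- z) / (1 + exp (- z)) = s z"
      using nz(1)[OF that] by (simp add: s_def exp_minus divide_simps add.commute)
    moreover have "(g has_field_derivative - (exp (- z) / (1 + exp (- z)))) (at z)"
      unfolding g_def using nz[of "-z"] that
      by (auto intro!: derivative_eq_intros simp: divide_inverse mult.commute)
    ultimately show ?thesis by simp
  qed
  have d0: "((\<lambda>z. - Ln (g z)) has_field_derivative s z / g z) (at z)" if "norm z < 1" for z
    using gnz[OF that] by (auto intro!: derivative_eq_intros g that simp: divide_inverse mult.commute)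
  have d1: "((\<lambda>z. s z / g z) has_field_derivative
      - (s z * (1 - s z)) / g z + (s z)\<^sup>2 / (g z)\<^sup>2) (at z)" if "norm z < 1" for z
    using gnz[OF that] by (auto intro!: derivative_eq_intros s g that simp: field_simps power2_eq_square)
  have d2: "((\<lambda>z. - (s z * (1 - s z)) / g z + (s z)\<^sup>2 / (g z)\<^sup>2) has_field_derivative
      s z * (1 - s z) * (1 - 2 * s z) / g z - 3 * (s z)\<^sup>2 * (1 - s z) / (g z)\<^sup>2
      + 2 * (s z) ^ 3 / (g z) ^ 3) (at z)" if "norm z < 1" for z
  proof -
    have "((\<lambda>z. - (s z * (1 - s z))) has_field_derivative s z * (1 - s z) * (1 - 2 * s z)) (at z)"
      by (rule derivative_eq_intros s that refl)+ (simp add: algebra_simps)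
    note d = DERIV_divide[OF this g[OF that] gnz(1)[OF that]]
    have "((\<lambda>z. - (s z * (1 - s z)) / g z) has_field_derivative
        s z * (1 - s z) * (1 - 2 * s z) / g z - (s z)\<^sup>2 * (1 - s z) / (g z)\<^sup>2) (at z)"
      by (rule DERIV_cong[OF d]) (use gnz(1)[OF that] in \<open>simp add: field_simps power2_eq_square\<close>)
    moreover have "((\<lambda>z. (s z / g z) ^ 2) has_field_derivative
        of_nat 2 * ((- (s z * (1 - s z)) / g z + (s z)\<^sup>2 / (g z)\<^sup>2) * (s z / g z) ^ (2 - 1))) (at z)"
      using DERIV_power[OF d1[OF that], of 2] by simp
    then have "((\<lambda>z. (s z)\<^sup>2 / (g z)\<^sup>2) has_field_derivative
        2 * (s z) ^ 3 / (g z) ^ 3 - 2 * (s z)\<^sup>2 * (1 - s z) / (g z)\<^sup>2) (at z)"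
      unfolding power_divide
      by (rule DERIV_cong) (use gnz(1)[OF that] in \<open>simp add: field_simps power2_eq_square power3_eq_cube\<close>)
    ultimately show ?thesis
      by (rule DERIV_add[THEN DERIV_cong]) (simp add: algebra_simps add_divide_distrib diff_divide_distrib)
  qed
  have Ln2: "Ln 2 = of_real (ln 2)" by (metis Ln_of_real of_real_numeral zero_less_numeral)
  have s0: "s 0 = 1 / 2" by (simp add: s_def)
  have g0: "g 0 = of_real (ln 2)" by (simp add: g_def Ln2)
  have Lng0: "Ln (g 0) = of_real (ln (ln 2))" unfolding g0 by (rule Ln_of_real) simp
  obtain B where "B > 0" and B: "\<And>z. norm z \<le> 1/2 \<Longrightarrow>
    norm (- Ln (g z) - (- Ln (g 0) + (s 0 / g 0) * z
       + (- (s 0 * (1 - s 0)) / g 0 + (s 0)\<^sup>2 / (g 0)\<^sup>2) * z^2 / 2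
       + (s 0 * (1 - s 0) * (1 - 2 * s 0) / g 0 - 3 * (s 0)\<^sup>2 * (1 - s 0) / (g 0)\<^sup>2
      + 2 * (s 0) ^ 3 / (g 0) ^ 3) * z^3 / 6)) \<le> B * norm z ^ 4"
    using holomorphic_Taylor3[OF d0 d1 d2] by blast
  have c1: "s 0 / g 0 = of_real (1 / (2 * ln 2))"
    by (simp add: s0 g0)
  have c2: "- (s 0 * (1 - s 0)) / g 0 + (s 0)\<^sup>2 / (g 0)\<^sup>2 = of_real ((1 - ln 2) / (2 * ln 2)^2)"
    by (simp add: s0 g0 field_simps power2_eq_square)
  have c3: "s 0 * (1 - s 0) * (1 - 2 * s 0) / g 0 - 3 * (s 0)\<^sup>2 * (1 - s 0) / (g 0)\<^sup>2
      + 2 * (s 0) ^ 3 / (g 0) ^ 3 = of_real ((2 - 3 * ln 2) / (2 * ln 2)^3)"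
    by (simp add: s0 g0 field_simps power2_eq_square power3_eq_cube)
  show ?thesis
    using that[OF \<open>B > 0\<close>] B unfolding c1 c2 c3 Lng0 by (simp add: g_def)
qed

text \<open>The two Taylor expansions are inserted at \<open>z = i\<theta>\<close>. The factor \<open>1 / (1 + u)\<close> is responsible for
  the constants \<open>- 1/2\<close> and \<open>- 1/4\<close> in \<open>a\<^sub>n\<close> and \<open>b\<^sub>n\<close>; it contributes nothing to the cubic term.\<close>

lemma dominant_term_expansion:
  obtains B where "B > 0"
    "\<And>n \<theta>. \<bar>\<theta>\<bar> \<le> 1/2 \<Longrightarrow> \<exists>r. norm r \<le> B * (real n + 1) * \<theta> ^ 4 \<and>
       2 * of_real (ln 2) ^ (n + 1) / ((1 + exp (\<i> * of_real \<theta>)) * dominant_pole \<theta> ^ (n + 1)) =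
       exp (\<i> * of_real (mean_a n * \<theta>) - of_real (var_b n * \<theta>\<^sup>2 / 2)
         - \<i> * of_real ((real n + 1) * ((2 - 3 * ln 2) / (2 * ln 2)^3) / 6 * \<theta>^3) + r)"
proof -
  obtain B0 where B0: "B0 > 0" "\<And>z. norm z \<le> 1/2 \<Longrightarrow>
    norm (- Ln (1 + exp z) - (- of_real (ln 2) - z / 2 - z\<^sup>2 / 8)) \<le> B0 * norm z ^ 4"
    using Taylor_Ln_one_plus_exp by blast
  obtain B1 where B1: "B1 > 0" "\<And>z. norm z \<le> 1/2 \<Longrightarrow>
    norm (- Ln (Ln (1 + exp (- z))) - (- of_real (ln (ln 2)) + of_real (1 / (2 * ln 2)) * z
      + of_real ((1 - ln 2) / (2 * ln 2)^2) * z\<^sup>2 / 2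
      + of_real ((2 - 3 * ln 2) / (2 * ln 2)^3) * z^3 / 6)) \<le> B1 * norm z ^ 4"
    using Taylor_Ln_Ln_one_plus_exp by blast
  have "\<exists>r. norm r \<le> (B0 + B1) * (real n + 1) * \<theta> ^ 4 \<and>
       2 * of_real (ln 2) ^ (n + 1) / ((1 + exp (\<i> * of_real \<theta>)) * dominant_pole \<theta> ^ (n + 1)) =
       exp (\<i> * of_real (mean_a n * \<theta>) - of_real (var_b n * \<theta>\<^sup>2 / 2)
         - \<i> * of_real ((real n + 1) * ((2 - 3 * ln 2) / (2 * ln 2)^3) / 6 * \<theta>^3) + r)"
    if \<theta>: "\<bar>\<theta>\<bar> \<le> 1/2" for n \<theta>
  proof -
    define z where "z = \<i> * complex_of_real \<theta>"
    define v k where "v = (1 - ln 2) / (2 * ln 2 :: real)^2" and "k = (2 - 3 * ln 2) / (2 * ln 2 :: real)^3"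
    define m where "m = 1 / (2 * ln 2 :: real)"
    have z: "norm z = \<bar>\<theta>\<bar>" "norm z \<le> 1/2" using \<theta> by (auto simp: z_def norm_mult)
    define L0 where "L0 = - Ln (1 + exp z)"
    define L1 where "L1 = - Ln (Ln (1 + exp (- z)))"
    define r0 where "r0 = L0 - (- of_real (ln 2) - z / 2 - z\<^sup>2 / 8)"
    define r1 where "r1 = L1 - (- of_real (ln (ln 2)) + of_real m * z + of_real v * z\<^sup>2 / 2 + of_real k * z^3 / 6)"
    define r where "r = r0 + of_nat (n + 1) * r1"
    have "norm r \<le> norm r0 + real (n + 1) * norm r1"
      unfolding r_def by (rule order_trans[OF norm_triangle_ineq]) (simp only: norm_mult norm_of_nat)
    also have "\<dots> \<le> B0 * \<theta>^4 + real (n + 1) * (B1 * \<theta>^4)"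
      using B0(2)[OF z(2)] B1(2)[OF z(2)]
      by (intro add_mono mult_left_mono) (auto simp: r0_def r1_def L0_def L1_def z(1) m_def v_def k_def)
    also have "\<dots> \<le> real (n + 1) * (B0 * \<theta>^4) + real (n + 1) * (B1 * \<theta>^4)"
      using mult_right_mono[of 1 "real (n + 1)" "B0 * \<theta> ^ 4"] B0(1) by simp
    also have "\<dots> = (B0 + B1) * (real n + 1) * \<theta> ^ 4" by (simp add: algebra_simps)
    finally have r: "norm r \<le> (B0 + B1) * (real n + 1) * \<theta> ^ 4" .
    have "1 + exp z \<noteq> 0"
      using Re_exp_pos[of z] z by (auto simp: complex_eq_iff)
    then have e0: "exp L0 = 1 / (1 + exp z)"
      unfolding L0_def exp_minus by (simp add: inverse_eq_divide)
    have e1: "exp L1 = 1 / dominant_pole \<theta>"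
      using dominant_pole_nonzero[of \<theta>] \<theta>
      unfolding L1_def z_def exp_minus dominant_pole_def by (simp add: inverse_eq_divide)
    have l2: "exp (of_real (ln 2)) = (2::complex)" "exp (of_real (ln (ln 2))) = complex_of_real (ln 2)"
      by (simp_all add: exp_of_real)
    have "2 * of_real (ln 2) ^ (n + 1) / ((1 + exp (\<i> * of_real \<theta>)) * dominant_pole \<theta> ^ (n + 1))
        = exp (of_real (ln 2)) * exp L0 * (exp (of_real (ln (ln 2))) * exp L1) ^ (n + 1)"
      unfolding l2 e0 e1 z_def[symmetric] by (simp add: power_divide)
    also have "\<dots> = exp (of_real (ln 2) + L0 + of_nat (n + 1) * (of_real (ln (ln 2)) + L1))"
      by (simp only: exp_add exp_of_nat_mult)
    also have "of_real (ln 2) + L0 + of_nat (n + 1) * (of_real (ln (ln 2)) + L1) =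
        - z / 2 - z\<^sup>2 / 8 + of_nat (n + 1) * (of_real m * z + of_real v * z\<^sup>2 / 2 + of_real k * z^3 / 6) + r"
      unfolding r_def r0_def r1_def by (simp add: algebra_simps)
    also have "z\<^sup>2 = - of_real (\<theta>\<^sup>2)" by (simp add: z_def power_mult_distrib)
    also have "z ^ 3 = - \<i> * of_real (\<theta>^3)"
    proof -
      have "\<i> ^ 3 = - \<i>" by (simp add: power3_eq_cube)
      then show ?thesis by (simp add: z_def power_mult_distrib)
    qed
    also have "- z / 2 - - of_real (\<theta>\<^sup>2) / 8 + of_nat (n + 1) * (of_real m * z + of_real v * - of_real (\<theta>\<^sup>2) / 2
          + of_real k * (- \<i> * of_real (\<theta>^3)) / 6) + r
        = \<i> * of_real (mean_a n * \<theta>) - of_real (var_b n * \<theta>\<^sup>2 / 2)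
          - \<i> * of_real ((real n + 1) * k / 6 * \<theta>^3) + r"
    proof -
      have a: "mean_a n = (real n + 1) * m - 1 / 2" by (simp add: mean_a_def m_def)
      have b: "var_b n = (real n + 1) * v - 1 / 4" by (simp add: var_b_def v_def)
      show ?thesis unfolding a b z_def by (simp add: algebra_simps add_divide_distrib diff_divide_distrib)
    qed
    finally show ?thesis using r unfolding k_def by blast
  qed
  with B0(1) B1(1) that[of "B0 + B1"] show ?thesis by (meson add_pos_pos)
qed

section \<open>Fourier representation of the Edgeworth density\<close>

definition gauss_wave :: "nat \<Rightarrow> real \<Rightarrow> real \<Rightarrow> complex"
  where "gauss_wave k x t = of_real (t ^ k * exp (- t\<^sup>2 / 2)) * exp (- (\<i> * of_real (t * x)))"

lemma integrable_abs_power_gauss: "integrable lborel (\<lambda>t::real. \<bar>t\<bar> ^ k * exp (- t\<^sup>2 / 2))"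
proof -
  have "integrable lborel (\<lambda>t. sqrt (2 * pi) * (std_normal_density t * \<bar>t\<bar> ^ k))"
    by (intro integrable_mult_right integrable_std_normal_moment_abs)
  then show ?thesis by (simp add: std_normal_density_def mult_ac)
qed

lemma integrable_gauss_wave: "integrable lborel (gauss_wave k x)"
proof (rule Bochner_Integration.integrable_bound[OF integrable_abs_power_gauss[of k]])
  have "continuous_on UNIV (gauss_wave k x)"
    unfolding gauss_wave_def by (intro continuous_intros) auto
  then show "gauss_wave k x \<in> borel_measurable lborel"
    using borel_measurable_continuous_onI by simp
qed (simp add: gauss_wave_def norm_mult norm_power abs_mult power_abs)

lemma integral_gauss_wave_0:
  "integral\<^sup>L lborel (gauss_wave 0 x) = of_real (sqrt (2 * pi) * exp (- x\<^sup>2 / 2))"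
proof -
  have "complex_of_real (exp (- x\<^sup>2 / 2)) = char std_normal_distribution (- x)"
    by (simp add: char_std_normal_distribution)
  also have "\<dots> = (CLBINT t. std_normal_density t *\<^sub>R exp (\<i> * of_real (- x * t)))"
    unfolding char_def by (subst integral_density) auto
  also have "\<dots> = (CLBINT t. of_real (1 / sqrt (2 * pi)) * gauss_wave 0 x t)"
    by (intro Bochner_Integration.integral_cong)
       (simp_all add: gauss_wave_def std_normal_density_def scaleR_conv_of_real mult_ac)
  also have "\<dots> = of_real (1 / sqrt (2 * pi)) * integral\<^sup>L lborel (gauss_wave 0 x)"
    by simp
  finally show ?thesis by (simp add: field_simps)
qed

lemma tendsto_gauss_wave_at_top: "(gauss_wave k x \<longlongrightarrow> 0) at_top"
proof (rule Lim_null_comparison)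
  have "((\<lambda>t::real. exp (1 / 2) * (t ^ k / exp t)) \<longlongrightarrow> exp (1 / 2) * 0) at_top"
    by (intro tendsto_mult_left tendsto_power_div_exp_0)
  then show "((\<lambda>t::real. exp (1 / 2) * (t ^ k / exp t)) \<longlongrightarrow> 0) at_top" by simp
  show "\<forall>\<^sub>F t in at_top. norm (gauss_wave k x t) \<le> exp (1 / 2) * (t ^ k / exp t)"
    using eventually_ge_at_top[of 0]
  proof eventually_elim
    case (elim t)
    have "- t\<^sup>2 / 2 \<le> 1 / 2 - t"
      using zero_le_power2[of "t - 1"] by (simp add: power2_eq_square algebra_simps)
    then have "exp (- t\<^sup>2 / 2) \<le> exp (1 / 2) / exp t" by (simp flip: exp_diff)
    then have "t ^ k * exp (- t\<^sup>2 / 2) \<le> t ^ k * (exp (1 / 2) / exp t)"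
      using elim by (intro mult_left_mono) auto
    then show ?case using elim by (simp add: gauss_wave_def norm_mult norm_power mult_ac)
  qed
qed

lemma tendsto_gauss_wave_at_bot: "(gauss_wave k x \<longlongrightarrow> 0) at_bot"
proof -
  have "((\<lambda>t. (- 1) ^ k * gauss_wave k (- x) t) \<longlongrightarrow> (- 1) ^ k * 0) at_top"
    by (intro tendsto_mult_left tendsto_gauss_wave_at_top)
  also have "(\<lambda>t. (- 1) ^ k * gauss_wave k (- x) t) = (\<lambda>t. gauss_wave k x (- t))"
  proof
    fix t :: real
    show "(- 1) ^ k * gauss_wave k (- x) t = gauss_wave k x (- t)"
      by (cases "even k") (simp_all add: gauss_wave_def)
  qed
  finally show ?thesis unfolding filterlim_at_bot_mirror by simp
qed

text \<open>The derivative of \<open>t\<^sup>k e\<^sup>-\<^sup>i\<^sup>t\<^sup>x exp (-t\<^sup>2/2)\<close>, a function that vanishes at both ends, integrates to 0.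
  For \<open>k = 0\<close> the truncated index \<open>k - 1\<close> is harmless because of the factor \<open>k\<close>.\<close>

lemma integral_gauss_wave_recurrence:
  "integral\<^sup>L lborel (gauss_wave (Suc k) x) =
     of_nat k * integral\<^sup>L lborel (gauss_wave (k - 1) x) - \<i> * of_real x * integral\<^sup>L lborel (gauss_wave k x)"
proof -
  define D where "D = (\<lambda>t. of_nat k * gauss_wave (k - 1) x t - gauss_wave (Suc k) x t
                        - \<i> * of_real x * gauss_wave k x t)"
  have wave_exp: "gauss_wave k x = (\<lambda>t. of_real (t ^ k) * exp (- ((of_real t)\<^sup>2 / 2 + \<i> * of_real (t * x))))" for k
  proof
    fix t :: real
    have "complex_of_real (exp (- t\<^sup>2 / 2)) = exp (- ((of_real t)\<^sup>2 / 2))"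
      by (subst exp_of_real[symmetric]) simp
    then show "gauss_wave k x t = of_real (t ^ k) * exp (- ((of_real t)\<^sup>2 / 2 + \<i> * of_real (t * x)))"
      unfolding gauss_wave_def minus_add_distrib exp_add of_real_mult by simp
  qed
  have int: "integrable lborel D"
    unfolding D_def by (intro Bochner_Integration.integrable_diff integrable_mult_right integrable_gauss_wave)
  have "(LBINT t=-\<infinity>..\<infinity>. D t) = 0 - 0"
  proof (rule interval_integral_FTC_integrable[where F = "gauss_wave k x"])
    fix t :: real
    have "((\<lambda>s. s ^ k * exp (- (s\<^sup>2 / 2 + \<i> * (s * of_real x)))) has_field_derivative
       (of_nat k * of_real t ^ (k - 1) * exp (- ((of_real t)\<^sup>2 / 2 + \<i> * (of_real t * of_real x)))
       + of_real t ^ k * (- (of_real t + \<i> * of_real x) * exp (- ((of_real t)\<^sup>2 / 2 + \<i> * (of_real t * of_real x)))))) (at (of_real t))"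
      by (rule derivative_eq_intros refl | simp)+
    then have "((\<lambda>t. of_real t ^ k * exp (- ((of_real t)\<^sup>2 / 2 + \<i> * (of_real t * of_real x)))) has_vector_derivative
       (of_nat k * of_real t ^ (k - 1) * exp (- ((of_real t)\<^sup>2 / 2 + \<i> * (of_real t * of_real x)))
       + of_real t ^ k * (- (of_real t + \<i> * of_real x) * exp (- ((of_real t)\<^sup>2 / 2 + \<i> * (of_real t * of_real x)))))) (at t)"
      by (rule has_vector_derivative_real_field)
    then show "(gauss_wave k x has_vector_derivative D t) (at t)"
      unfolding D_def wave_exp by (simp add: algebra_simps)
    show "isCont D t"
      unfolding D_def wave_exp by (intro continuous_intros) auto
  next
    show "set_integrable lborel (einterval (-\<infinity>) \<infinity>) D"
      using int by (simp add: set_integrable_def einterval_def)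
    show "((gauss_wave k x \<circ> real_of_ereal) \<longlongrightarrow> 0) (at_right (-\<infinity>))"
      using tendsto_gauss_wave_at_bot[of k x] by (simp add: ereal_tendsto_simps)
    show "((gauss_wave k x \<circ> real_of_ereal) \<longlongrightarrow> 0) (at_left \<infinity>)"
      using tendsto_gauss_wave_at_top[of k x] by (simp add: ereal_tendsto_simps)
  qed auto
  then have "integral\<^sup>L lborel D = 0"
    by (simp add: interval_lebesgue_integral_def set_lebesgue_integral_def einterval_def)
  also have "integral\<^sup>L lborel D = of_nat k * integral\<^sup>L lborel (gauss_wave (k - 1) x)
      - integral\<^sup>L lborel (gauss_wave (Suc k) x) - \<i> * of_real x * integral\<^sup>L lborel (gauss_wave k x)"
    unfolding D_def by (simp add: integrable_gauss_wave)
  finally show ?thesis by (simp add: algebra_simps)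
qed

text \<open>Three steps of the recurrence produce the Hermite polynomial \<open>x\<^sup>3 - 3x\<close>.\<close>

lemma integral_gauss_wave_3:
  "integral\<^sup>L lborel (gauss_wave 3 x) = \<i> * of_real ((x ^ 3 - 3 * x) * sqrt (2 * pi) * exp (- x\<^sup>2 / 2))"
proof -
  have "integral\<^sup>L lborel (gauss_wave 3 x) = \<i> * of_real (x ^ 3 - 3 * x) * integral\<^sup>L lborel (gauss_wave 0 x)"
  proof -
    have I1: "integral\<^sup>L lborel (gauss_wave 1 x) = - \<i> * of_real x * integral\<^sup>L lborel (gauss_wave 0 x)"
      using integral_gauss_wave_recurrence[of 0 x] by simp
    have I2: "integral\<^sup>L lborel (gauss_wave 2 x) = integral\<^sup>L lborel (gauss_wave 0 x)
        - \<i> * of_real x * integral\<^sup>L lborel (gauss_wave 1 x)"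
      using integral_gauss_wave_recurrence[of 1 x] by (simp add: numeral_2_eq_2)
    have "integral\<^sup>L lborel (gauss_wave 3 x) = 2 * integral\<^sup>L lborel (gauss_wave 1 x)
        - \<i> * of_real x * integral\<^sup>L lborel (gauss_wave 2 x)"
      using integral_gauss_wave_recurrence[of 2 x] by (simp add: numeral_3_eq_3)
    also have "\<dots> = \<i> * of_real (x ^ 3 - 3 * x) * integral\<^sup>L lborel (gauss_wave 0 x)"
      unfolding I2 I1 by (simp add: power3_eq_cube algebra_simps)
    finally show ?thesis .
  qed
  then show ?thesis by (simp add: integral_gauss_wave_0)
qed

text \<open>The substitution \<open>t = \<surd>b \<theta>\<close> reduces this to the standard normal case, where the constant term gives
  the Gaussian and the cubic term gives the Gaussian times the third Hermite polynomial.\<close>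

lemma edgeworth_density_fourier:
  fixes b \<nu> y :: real
  assumes b: "b > 0"
  defines "x \<equiv> y / sqrt b"
  shows "integrable lborel (\<lambda>\<theta>. exp (- (\<i> * of_real (\<theta> * y))) *
           (of_real (exp (- (b * \<theta>\<^sup>2 / 2))) * (1 - \<i> * of_real (\<nu> * \<theta> ^ 3))))" (is "integrable lborel ?f")
    and "of_real (sqrt b / (2 * pi)) * integral\<^sup>L lborel (\<lambda>\<theta>. exp (- (\<i> * of_real (\<theta> * y))) *
           (of_real (exp (- (b * \<theta>\<^sup>2 / 2))) * (1 - \<i> * of_real (\<nu> * \<theta> ^ 3)))) =
         of_real (1 / sqrt (2 * pi) * exp (- x\<^sup>2 / 2) * (1 + \<nu> / sqrt b ^ 3 * (x ^ 3 - 3 * x)))"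
proof -
  define \<mu> where "\<mu> = \<nu> / sqrt b ^ 3"
  define g where "g = (\<lambda>t. gauss_wave 0 x t - \<i> * of_real \<mu> * gauss_wave 3 x t)"
  have g: "integrable lborel g"
    unfolding g_def by (intro Bochner_Integration.integrable_diff integrable_mult_right integrable_gauss_wave)
  have sb: "sqrt b > 0" using b by simp
  have f: "?f = (\<lambda>\<theta>. g (0 + sqrt b * \<theta>))"
  proof
    fix \<theta>
    have "sqrt b * \<theta> * x = \<theta> * y" "(sqrt b * \<theta>)\<^sup>2 = b * \<theta>\<^sup>2" "\<mu> * (sqrt b * \<theta>) ^ 3 = \<nu> * \<theta> ^ 3"
      using b sb by (simp_all add: x_def \<mu>_def power_mult_distrib)
    moreover have "g (0 + sqrt b * \<theta>) = exp (- (\<i> * of_real (sqrt b * \<theta> * x))) * (of_real (exp (- ((sqrt b * \<theta>)\<^sup>2 / 2)))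
        * (1 - \<i> * of_real (\<mu> * (sqrt b * \<theta>) ^ 3)))"
      unfolding g_def gauss_wave_def by (simp add: algebra_simps)
    ultimately show "?f \<theta> = g (0 + sqrt b * \<theta>)" by metis
  qed
  show "integrable lborel ?f"
    unfolding f using sb by (intro lborel_integrable_real_affine g) auto
  have "integral\<^sup>L lborel g = of_real (sqrt b) * integral\<^sup>L lborel ?f"
    using lborel_integral_real_affine[of "sqrt b" g 0] sb unfolding f
    by (simp add: scaleR_conv_of_real)
  moreover have "integral\<^sup>L lborel g = of_real (sqrt (2 * pi) * exp (- x\<^sup>2 / 2) * (1 + \<mu> * (x ^ 3 - 3 * x)))"
    unfolding g_def
  proof -
    have "integral\<^sup>L lborel (\<lambda>t. gauss_wave 0 x t - \<i> * of_real \<mu> * gauss_wave 3 x t) =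
        integral\<^sup>L lborel (gauss_wave 0 x) - \<i> * of_real \<mu> * integral\<^sup>L lborel (gauss_wave 3 x)"
      by (simp add: integrable_gauss_wave)
    also have "\<dots> = of_real (sqrt (2 * pi) * exp (- x\<^sup>2 / 2)) - \<i> * of_real \<mu> *
        (\<i> * of_real ((x ^ 3 - 3 * x) * sqrt (2 * pi) * exp (- x\<^sup>2 / 2)))"
      unfolding integral_gauss_wave_0 integral_gauss_wave_3 ..
    also have "\<dots> = of_real (sqrt (2 * pi) * exp (- x\<^sup>2 / 2)) + of_real (\<mu> *
        ((x ^ 3 - 3 * x) * sqrt (2 * pi) * exp (- x\<^sup>2 / 2)))"
    proof -
      have "c - \<i> * of_real \<mu> * (\<i> * of_real d) = c + of_real (\<mu> * d)" for c and d :: real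
      proof -
        have "\<i> * of_real \<mu> * (\<i> * of_real d) = (\<i> * \<i>) * of_real (\<mu> * d)"
          unfolding of_real_mult by (simp only: mult_ac)
        then show ?thesis by simp
      qed
      then show ?thesis .
    qed
    also have "\<dots> = of_real (sqrt (2 * pi) * exp (- x\<^sup>2 / 2) * (1 + \<mu> * (x ^ 3 - 3 * x)))"
      unfolding of_real_add[symmetric] by (intro arg_cong[where f = of_real]) algebra
    finally show "integral\<^sup>L lborel (\<lambda>t. gauss_wave 0 x t - \<i> * of_real \<mu> * gauss_wave 3 x t) =
        of_real (sqrt (2 * pi) * exp (- x\<^sup>2 / 2) * (1 + \<mu> * (x ^ 3 - 3 * x)))" .
  qed
  ultimately have "of_real (sqrt b) * integral\<^sup>L lborel ?f =
      of_real (sqrt (2 * pi) * exp (- x\<^sup>2 / 2) * (1 + \<mu> * (x ^ 3 - 3 * x)))" by (rule trans[OF sym])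
  then have "of_real (1 / (2 * pi)) * (of_real (sqrt b) * integral\<^sup>L lborel ?f) =
      of_real (1 / (2 * pi) * (sqrt (2 * pi) * exp (- x\<^sup>2 / 2) * (1 + \<mu> * (x ^ 3 - 3 * x))))"
    by (simp only: of_real_mult)
  also have "1 / (2 * pi) * (sqrt (2 * pi) * exp (- x\<^sup>2 / 2) * (1 + \<mu> * (x ^ 3 - 3 * x))) =
      1 / sqrt (2 * pi) * exp (- x\<^sup>2 / 2) * (1 + \<mu> * (x ^ 3 - 3 * x))"
  proof -
    have "1 / (2 * pi) * sqrt (2 * pi) = 1 / sqrt (2 * pi)"
      using real_sqrt_mult_self[of "2 * pi"] by (simp add: divide_simps del: real_sqrt_mult_self)
    then show ?thesis by (metis mult.assoc)
  qed
  also have "of_real (1 / (2 * pi)) * (of_real (sqrt b) * integral\<^sup>L lborel ?f) =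
      of_real (sqrt b / (2 * pi)) * integral\<^sup>L lborel ?f"
    by simp
  finally show "of_real (sqrt b / (2 * pi)) * integral\<^sup>L lborel ?f =
       of_real (1 / sqrt (2 * pi) * exp (- x\<^sup>2 / 2) * (1 + \<nu> / sqrt b ^ 3 * (x ^ 3 - 3 * x)))"
    unfolding \<mu>_def .
qed

section \<open>Fourier inversion and estimates of the integrands\<close>

lemma integral_iexp_period:
  "(CLBINT \<theta>. indicator {-pi..pi} \<theta> *\<^sub>R exp (\<i> * of_real (\<theta> * of_int m))) =
     (if m = 0 then of_real (2 * pi) else 0)"
proof (cases "m = 0")
  case False
  define F where "F = (\<lambda>\<theta>::real. exp (\<i> * of_real (\<theta> * of_int m)) / (\<i> * of_int m))"
  have "(CLBINT \<theta>. indicator {-pi..pi} \<theta> *\<^sub>R exp (\<i> * of_real (\<theta> * of_int m))) = F pi - F (- pi)"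
  proof (rule integral_FTC_atLeastAtMost)
    fix x :: real
    have "((\<lambda>z. exp (\<i> * (z * of_int m)) / (\<i> * of_int m)) has_field_derivative
        exp (\<i> * (of_real x * of_int m))) (at (of_real x))"
      using False by (auto intro!: derivative_eq_intros simp: mult_ac)
    from has_vector_derivative_real_field[OF this]
    show "(F has_vector_derivative exp (\<i> * of_real (x * of_int m))) (at x within {-pi..pi})"
      unfolding F_def by simp
  qed (auto intro!: continuous_intros)
  also have "F pi = F (- pi)"
  proof -
    have "cis (pi * of_int m) = cis (- pi * of_int m)"
      by (auto simp: complex_eq_iff)
    then show ?thesis unfolding F_def by (simp add: cis_conv_exp)
  qed
  finally show ?thesis using False by simp
qed (simp add: scaleR_conv_of_real)

lemma integrable_indicator_iexp:
  "integrable lborel (\<lambda>\<theta>. indicator {-pi..pi} \<theta> *\<^sub>R exp (\<i> * of_real (\<theta> * c)))"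
  by (intro borel_integrable_compact continuous_intros) auto

text \<open>Extraction of a coefficient of a polynomial from its values on the unit circle. For negative \<open>j\<close>, and
  for \<open>j > n\<close>, no coefficient is hit and the integral is 0, in accordance with the convention for
  \<open>j! S(n,j)\<close>.\<close>

lemma fact_Stirling_fourier:
  "complex_of_real (fact_Stirling n j) = of_real (1 / (2 * pi)) *
     (CLBINT \<theta>. indicator {-pi..pi} \<theta> *\<^sub>R
        (geometric_poly n (exp (\<i> * of_real \<theta>)) * exp (- (\<i> * of_real (\<theta> * of_int j)))))"
proof -
  define c where "c = (\<lambda>k. of_nat (fact k * Stirling n k) :: complex)"
  have "(CLBINT \<theta>. indicator {-pi..pi} \<theta> *\<^sub>R
        (geometric_poly n (exp (\<i> * of_real \<theta>)) * exp (- (\<i> * of_real (\<theta> * of_int j)))))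
     = (CLBINT \<theta>. (\<Sum>k\<le>n. c k * (indicator {-pi..pi} \<theta> *\<^sub>R exp (\<i> * of_real (\<theta> * of_int (int k - j))))))"
  proof (rule Bochner_Integration.integral_cong)
    fix \<theta> :: real
    have "exp (\<i> * of_real \<theta>) ^ k * exp (- (\<i> * of_real (\<theta> * of_int j)))
        = exp (\<i> * of_real (\<theta> * of_int (int k - j)))" for k
      unfolding exp_of_nat_mult[symmetric] exp_add[symmetric] by (simp add: algebra_simps)
    then show "indicator {-pi..pi} \<theta> *\<^sub>R
        (geometric_poly n (exp (\<i> * of_real \<theta>)) * exp (- (\<i> * of_real (\<theta> * of_int j))))
       = (\<Sum>k\<le>n. c k * (indicator {-pi..pi} \<theta> *\<^sub>R exp (\<i> * of_real (\<theta> * of_int (int k - j)))))"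
      unfolding geometric_poly_def c_def sum_distrib_right scaleR_sum_right
      by (intro sum.cong refl) (simp only: mult.assoc mult_scaleR_right)
  qed simp
  also have "\<dots> = (\<Sum>k\<le>n. c k * (if int k - j = 0 then of_real (2 * pi) else 0))"
    by (subst Bochner_Integration.integral_sum)
       (simp_all only: integral_mult_right_zero integral_iexp_period integrable_mult_right integrable_indicator_iexp)
  also have "\<dots> = of_real (2 * pi) * of_real (fact_Stirling n j)"
  proof (cases "j < 0")
    case False
    then have "(\<Sum>k\<le>n. c k * (if int k - j = 0 then of_real (2 * pi) else 0))
        = (\<Sum>k\<le>n. if k = nat j then c (nat j) * of_real (2 * pi) else 0)"
      by (intro sum.cong) auto
    also have "\<dots> = c (nat j) * of_real (2 * pi)"
      by (simp add: c_def)
    finally show ?thesis using False by (simp add: fact_Stirling_def c_def)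
  qed (auto simp: fact_Stirling_def intro!: sum.neutral)
  finally show ?thesis by simp
qed

text \<open>With \<open>w = - i \<nu> \<theta>\<^sup>3 + r\<close> the difference is \<open>exp (- b \<theta>\<^sup>2 / 2) (e\<^sup>w - 1 - w + r)\<close>, and
  \<open>\<bar>e\<^sup>w - 1 - w\<bar> \<le> \<bar>w\<bar>\<^sup>2 e\<^sup>\<bar>\<^sup>w\<^sup>\<bar>\<close>. The restriction on \<open>\<theta>\<close> yields \<open>\<bar>w\<bar> \<le> \<beta> N \<theta>\<^sup>2 / 4\<close>, so the factor
  \<open>e\<^sup>\<bar>\<^sup>w\<^sup>\<bar>\<close> uses up only half of the Gaussian exponent, while \<open>\<bar>w\<bar>\<^sup>2\<close> is of order \<open>N\<^sup>2 \<theta>\<^sup>6\<close>.\<close>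

lemma exp_cubic_perturbation:
  fixes r :: complex
  assumes N: "N \<ge> 0" and b: "b \<ge> \<beta> * N" and \<nu>: "\<bar>\<nu>\<bar> \<le> K * N" and r: "norm r \<le> B * N * \<theta> ^ 4"
    and \<theta>: "\<bar>\<theta>\<bar> \<le> 1" "(K + B) * \<bar>\<theta>\<bar> \<le> \<beta> / 4" and KB: "K \<ge> 0" "B \<ge> 0"
  shows "norm (exp (- of_real (b * \<theta>\<^sup>2 / 2) - \<i> * of_real (\<nu> * \<theta> ^ 3) + r)
      - of_real (exp (- (b * \<theta>\<^sup>2 / 2))) * (1 - \<i> * of_real (\<nu> * \<theta> ^ 3)))
    \<le> ((K + B)\<^sup>2 + B) * ((N * \<theta> ^ 4 + N\<^sup>2 * \<theta> ^ 6) * exp (- (\<beta> * N * \<theta>\<^sup>2 / 4)))"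
proof -
  define w where "w = - (\<i> * of_real (\<nu> * \<theta> ^ 3)) + r"
  define E where "E = exp (- (\<beta> * N * \<theta>\<^sup>2 / 4))"
  have abs_pow: "\<bar>\<theta>\<bar> ^ 4 = \<theta> ^ 4" "\<bar>\<theta>\<bar> ^ 2 = \<theta>\<^sup>2" "(\<bar>\<theta>\<bar> ^ 3)\<^sup>2 = \<theta> ^ 6"
    by (simp_all add: power_even_abs flip: power_mult)
  have "norm w \<le> \<bar>\<nu>\<bar> * \<bar>\<theta>\<bar> ^ 3 + norm r"
    unfolding w_def by (rule order_trans[OF norm_triangle_ineq]) (simp add: norm_mult norm_power abs_mult power_abs)
  also have "\<dots> \<le> K * N * \<bar>\<theta>\<bar> ^ 3 + B * N * \<bar>\<theta>\<bar> ^ 4"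
    using \<nu> r by (intro add_mono mult_right_mono) (auto simp: abs_pow)
  also have "\<dots> \<le> K * N * \<bar>\<theta>\<bar> ^ 3 + B * N * \<bar>\<theta>\<bar> ^ 3"
    using \<theta> N KB by (intro add_mono mult_left_mono power_decreasing) auto
  also have "\<dots> = (K + B) * N * \<bar>\<theta>\<bar> ^ 3" by (simp add: algebra_simps)
  finally have w1: "norm w \<le> (K + B) * N * \<bar>\<theta>\<bar> ^ 3" .
  also have "\<dots> = ((K + B) * \<bar>\<theta>\<bar>) * (N * \<theta>\<^sup>2)"
    by (simp add: power3_eq_cube power2_eq_square abs_mult_self_eq flip: abs_mult)
  also have "\<dots> \<le> \<beta> / 4 * (N * \<theta>\<^sup>2)"
    using \<theta> N by (intro mult_right_mono) auto
  finally have w2: "norm w \<le> \<beta> * N * \<theta>\<^sup>2 / 4" by simp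
  have "\<beta> * N * \<theta>\<^sup>2 \<le> b * \<theta>\<^sup>2" using b by (intro mult_right_mono) auto
  then have bE: "- (b * \<theta>\<^sup>2 / 2) + norm w \<le> - (\<beta> * N * \<theta>\<^sup>2 / 4)" using w2 by simp
  have E1: "exp (- (b * \<theta>\<^sup>2 / 2)) * exp (norm w) \<le> E"
    unfolding E_def exp_add[symmetric] using bE by simp
  have "exp (- (b * \<theta>\<^sup>2 / 2)) * 1 \<le> exp (- (b * \<theta>\<^sup>2 / 2)) * exp (norm w)"
    by (intro mult_left_mono) auto
  from order_trans[OF this E1] have E2: "exp (- (b * \<theta>\<^sup>2 / 2)) \<le> E" by simp
  have "exp (- of_real (b * \<theta>\<^sup>2 / 2) - \<i> * of_real (\<nu> * \<theta> ^ 3) + r) = of_real (exp (- (b * \<theta>\<^sup>2 / 2))) * exp w"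
    unfolding w_def exp_of_real[symmetric] by (simp only: exp_add[symmetric]) (simp add: algebra_simps)
  then have "norm (exp (- of_real (b * \<theta>\<^sup>2 / 2) - \<i> * of_real (\<nu> * \<theta> ^ 3) + r)
      - of_real (exp (- (b * \<theta>\<^sup>2 / 2))) * (1 - \<i> * of_real (\<nu> * \<theta> ^ 3)))
      = norm (of_real (exp (- (b * \<theta>\<^sup>2 / 2))) * ((exp w - (1 + w)) + r))"
    by (intro arg_cong[where f = norm]) (simp add: w_def algebra_simps)
  also have "\<dots> \<le> exp (- (b * \<theta>\<^sup>2 / 2)) * (norm (exp w - (1 + w)) + norm r)"
    unfolding norm_mult by (simp add: norm_triangle_ineq)
  also have "\<dots> \<le> exp (- (b * \<theta>\<^sup>2 / 2)) * (exp (norm w) * (norm w)\<^sup>2 + norm r)"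
  proof -
    have "norm (exp w - (1 + w)) \<le> exp \<bar>Re w\<bar> * (norm w)\<^sup>2"
      using Taylor_exp[of w 1] by (simp add: power2_eq_square)
    also have "\<dots> \<le> exp (norm w) * (norm w)\<^sup>2"
      using abs_Re_le_cmod[of w] by (intro mult_right_mono) auto
    finally show ?thesis by (intro mult_left_mono add_right_mono) auto
  qed
  also have "\<dots> = (exp (- (b * \<theta>\<^sup>2 / 2)) * exp (norm w)) * (norm w)\<^sup>2 + exp (- (b * \<theta>\<^sup>2 / 2)) * norm r"
    by (simp add: algebra_simps)
  also have "\<dots> \<le> E * ((K + B) * N * \<bar>\<theta>\<bar> ^ 3)\<^sup>2 + E * (B * N * \<theta> ^ 4)"
    using E1 E2 w1 r by (intro add_mono mult_mono power_mono) (auto simp: E_def)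
  also have "\<dots> = E * ((K + B)\<^sup>2 * (N\<^sup>2 * \<theta> ^ 6) + B * (N * \<theta> ^ 4))"
    by (simp only: power_mult_distrib abs_pow) (simp only: ring_distribs mult_ac)
  also have "\<dots> \<le> E * (((K + B)\<^sup>2 + B) * (N * \<theta> ^ 4 + N\<^sup>2 * \<theta> ^ 6))"
  proof (rule mult_left_mono)
    have "0 \<le> (K + B)\<^sup>2 * (N * \<theta> ^ 4) + B * (N\<^sup>2 * \<theta> ^ 6)"
      using N KB by (intro add_nonneg_nonneg mult_nonneg_nonneg) (auto simp: zero_le_even_power)
    then show "(K + B)\<^sup>2 * (N\<^sup>2 * \<theta> ^ 6) + B * (N * \<theta> ^ 4) \<le> ((K + B)\<^sup>2 + B) * (N * \<theta> ^ 4 + N\<^sup>2 * \<theta> ^ 6)"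
      by (simp add: algebra_simps)
  qed (simp add: E_def)
  finally show ?thesis by (simp add: E_def mult_ac)
qed

text \<open>For \<open>\<bar>\<theta>\<bar> \<ge> \<delta>\<close> powers of \<open>\<bar>\<theta>\<bar> / \<delta>\<close> can be inserted at will. This brings the tail of the
  approximating function to the shape of the error bound near 0, so that one integral serves for both.\<close>

lemma edgeworth_tail:
  assumes N: "N \<ge> 1" and b: "b \<ge> \<beta> * N" and \<beta>: "\<beta> \<ge> 0" and \<nu>: "\<bar>\<nu>\<bar> \<le> K * N"
    and \<theta>: "\<delta> \<le> \<bar>\<theta>\<bar>" and \<delta>: "\<delta> > 0" and K: "K \<ge> 0"
  shows "norm (of_real (exp (- (b * \<theta>\<^sup>2 / 2))) * (1 - \<i> * complex_of_real (\<nu> * \<theta> ^ 3)))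
    \<le> (1 / \<delta> ^ 4 + K / \<delta>) * ((N * \<theta> ^ 4 + N\<^sup>2 * \<theta> ^ 6) * exp (- (\<beta> * N * \<theta>\<^sup>2 / 4)))"
proof -
  have "\<beta> * N * \<theta>\<^sup>2 \<le> b * \<theta>\<^sup>2" "0 \<le> \<beta> * N * \<theta>\<^sup>2"
    using b \<beta> N by (auto intro: mult_right_mono)
  then have "- (b * \<theta>\<^sup>2 / 2) \<le> - (\<beta> * N * \<theta>\<^sup>2 / 4)" by linarith
  then have E: "exp (- (b * \<theta>\<^sup>2 / 2)) \<le> exp (- (\<beta> * N * \<theta>\<^sup>2 / 4))" by (simp only: exp_le_cancel_iff)
  have t4: "\<bar>\<theta>\<bar> ^ 4 = \<theta> ^ 4" by (simp add: power_even_abs)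
  have one: "1 \<le> \<theta> ^ 4 / \<delta> ^ 4"
    using power_mono[OF \<theta>, of 4] \<delta> unfolding t4 by simp
  have "\<delta> * \<bar>\<theta>\<bar> ^ 3 \<le> \<bar>\<theta>\<bar> * \<bar>\<theta>\<bar> ^ 3" using \<theta> by (intro mult_right_mono) auto
  then have cube: "\<bar>\<theta>\<bar> ^ 3 \<le> \<theta> ^ 4 / \<delta>"
    using \<delta> unfolding t4[symmetric] by (simp add: field_simps power_Suc[symmetric] eval_nat_numeral)
  have "norm (1 - \<i> * complex_of_real (\<nu> * \<theta> ^ 3)) \<le> 1 + \<bar>\<nu>\<bar> * \<bar>\<theta>\<bar> ^ 3"
    by (rule order_trans[OF norm_triangle_ineq4]) (simp add: norm_mult norm_power abs_mult power_abs)
  also have "\<dots> \<le> \<theta> ^ 4 / \<delta> ^ 4 + (K * N) * (\<theta> ^ 4 / \<delta>)"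
    using one \<nu> cube K N by (intro add_mono mult_mono) auto
  also have "\<dots> \<le> N * (\<theta> ^ 4 / \<delta> ^ 4) + (K * N) * (\<theta> ^ 4 / \<delta>)"
    using mult_right_mono[OF N, of "\<theta> ^ 4 / \<delta> ^ 4"] \<delta> by simp
  also have "\<dots> = (1 / \<delta> ^ 4 + K / \<delta>) * (N * \<theta> ^ 4)"
    by (simp add: algebra_simps)
  also have "\<dots> \<le> (1 / \<delta> ^ 4 + K / \<delta>) * (N * \<theta> ^ 4 + N\<^sup>2 * \<theta> ^ 6)"
    using \<delta> K by (intro mult_left_mono) (auto simp: zero_le_even_power)
  finally have "norm (1 - \<i> * complex_of_real (\<nu> * \<theta> ^ 3)) \<le> (1 / \<delta> ^ 4 + K / \<delta>) * (N * \<theta> ^ 4 + N\<^sup>2 * \<theta> ^ 6)" .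
  then have "exp (- (b * \<theta>\<^sup>2 / 2)) * norm (1 - \<i> * complex_of_real (\<nu> * \<theta> ^ 3)) \<le>
      exp (- (\<beta> * N * \<theta>\<^sup>2 / 4)) * ((1 / \<delta> ^ 4 + K / \<delta>) * (N * \<theta> ^ 4 + N\<^sup>2 * \<theta> ^ 6))"
    using E by (intro mult_mono) auto
  then show ?thesis unfolding norm_mult by (simp add: mult_ac)
qed

text \<open>The scaling \<open>\<theta> = y / \<surd>N\<close> turns \<open>N \<theta>\<^sup>4\<close> and \<open>N\<^sup>2 \<theta>\<^sup>6\<close> into \<open>y\<^sup>4 / N\<close> and \<open>y\<^sup>6 / N\<close>, and the measure
  contributes another factor \<open>1 / \<surd>N\<close>.\<close>

lemma integral_scaled_moments:
  fixes \<beta> :: real assumes \<beta>: "\<beta> > 0"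
  obtains I where "\<And>N. N > 0 \<Longrightarrow>
     has_bochner_integral lborel (\<lambda>\<theta>. (N * \<theta> ^ 4 + N\<^sup>2 * \<theta> ^ 6) * exp (- (\<beta> * N * \<theta>\<^sup>2 / 4))) (I / (N * sqrt N))"
proof -
  define g where "g = (\<lambda>y::real. (y ^ 4 + y ^ 6) * exp (- (\<beta> * y\<^sup>2 / 4)))"
  define h where "h = (\<lambda>t::real. (1 / sqrt (\<beta> / 2) ^ 4 * t ^ 4 + 1 / sqrt (\<beta> / 2) ^ 6 * t ^ 6) * exp (- t\<^sup>2 / 2))"
  have "integrable lborel (\<lambda>t::real. 1 / sqrt (\<beta> / 2) ^ 4 * (\<bar>t\<bar> ^ 4 * exp (- t\<^sup>2 / 2)) + 1 / sqrt (\<beta> / 2) ^ 6 * (\<bar>t\<bar> ^ 6 * exp (- t\<^sup>2 / 2)))"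
    by (intro Bochner_Integration.integrable_add integrable_mult_right integrable_abs_power_gauss)
  then have "integrable lborel h"
    by (simp add: h_def algebra_simps power_even_abs)
  then have "integrable lborel (\<lambda>y. h (0 + sqrt (\<beta> / 2) * y))"
    using \<beta> by (intro lborel_integrable_real_affine) auto
  moreover have "h (0 + sqrt (\<beta> / 2) * y) = g y" for y
    using \<beta> by (simp add: h_def g_def power_mult_distrib mult.commute)
  ultimately have g: "integrable lborel g" by simp
  have "has_bochner_integral lborel (\<lambda>\<theta>. (N * \<theta> ^ 4 + N\<^sup>2 * \<theta> ^ 6) * exp (- (\<beta> * N * \<theta>\<^sup>2 / 4)))
      (integral\<^sup>L lborel g / (N * sqrt N))" if N: "N > 0" for N
  proof -
    have s4: "sqrt N ^ 4 = N\<^sup>2" "sqrt N ^ 6 = N ^ 3"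
      using N power_mult[of "sqrt N" 2 2] power_mult[of "sqrt N" 2 3] by simp_all
    have eq: "g (0 + sqrt N * \<theta>) = N * ((N * \<theta> ^ 4 + N\<^sup>2 * \<theta> ^ 6) * exp (- (\<beta> * N * \<theta>\<^sup>2 / 4)))" for \<theta>
      using N by (simp add: g_def power_mult_distrib s4 power2_eq_square power3_eq_cube algebra_simps)
    have "integrable lborel (\<lambda>\<theta>. g (0 + sqrt N * \<theta>))"
      using N by (intro lborel_integrable_real_affine g) auto
    then have int: "integrable lborel (\<lambda>\<theta>. (N * \<theta> ^ 4 + N\<^sup>2 * \<theta> ^ 6) * exp (- (\<beta> * N * \<theta>\<^sup>2 / 4)))"
      unfolding eq using N by simp
    have "integral\<^sup>L lborel g = sqrt N * (LBINT \<theta>. g (0 + sqrt N * \<theta>))"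
      using lborel_integral_real_affine[of "sqrt N" g 0] N by simp
    also have "\<dots> = sqrt N * (N * (LBINT \<theta>. (N * \<theta> ^ 4 + N\<^sup>2 * \<theta> ^ 6) * exp (- (\<beta> * N * \<theta>\<^sup>2 / 4))))"
      unfolding eq by simp
    finally have "(LBINT \<theta>. (N * \<theta> ^ 4 + N\<^sup>2 * \<theta> ^ 6) * exp (- (\<beta> * N * \<theta>\<^sup>2 / 4))) = integral\<^sup>L lborel g / (N * sqrt N)"
      using N by (simp add: field_simps)
    with int show ?thesis by (simp add: has_bochner_integral_iff)
  qed
  then show ?thesis using that by blast
qed

section \<open>Comparison of the characteristic functions\<close>

text \<open>One sixth of the third cumulant belonging to the dominant term.\<close>

definition cubic_coeff :: "nat \<Rightarrow> real"
  where "cubic_coeff n = (real n + 1) * ((2 - 3 * ln 2) / (2 * ln 2) ^ 3) / 6"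

text \<open>The characteristic function of the weights \<open>2 j! S(n,j) (ln 2)\<^sup>n\<^sup>+\<^sup>1 / n!\<close>, shifted by \<open>a\<^sub>n\<close>.\<close>

definition centred_char :: "nat \<Rightarrow> real \<Rightarrow> complex"
  where "centred_char n \<theta> = of_real (2 * ln 2 ^ (n + 1)) * (geometric_poly n (exp (\<i> * of_real \<theta>)) / fact n)
           * exp (- (\<i> * of_real (mean_a n * \<theta>)))"

text \<open>The characteristic function of the Edgeworth density with variance \<open>b\<^sub>n\<close> and mean 0.\<close>

definition edgeworth_char :: "nat \<Rightarrow> real \<Rightarrow> complex"
  where "edgeworth_char n \<theta> = of_real (exp (- (var_b n * \<theta>\<^sup>2 / 2))) * (1 - \<i> * of_real (cubic_coeff n * \<theta> ^ 3))"

text \<open>Two errors are added: the bounded contribution that the dominant pole leaves, damped by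
  \<open>(ln 2)\<^sup>n\<^sup>+\<^sup>1\<close>, and the deviation of the dominant term from the Edgeworth approximation. The radius
  \<open>\<delta>\<close> is chosen such that both the Taylor expansion and \<open>exp_cubic_perturbation\<close> apply.\<close>

lemma centred_char_near_0:
  assumes \<beta>: "\<beta> > 0"
  obtains A C \<delta> where "A \<ge> 0" "C \<ge> 0" "\<delta> > 0"
    "\<And>n \<theta>. \<bar>\<theta>\<bar> \<le> \<delta> \<Longrightarrow> \<beta> * (real n + 1) \<le> var_b n \<Longrightarrow>
       norm (centred_char n \<theta> - edgeworth_char n \<theta>) \<le> A * ln 2 ^ n +
         C * (((real n + 1) * \<theta> ^ 4 + (real n + 1)\<^sup>2 * \<theta> ^ 6) * exp (- (\<beta> * (real n + 1) * \<theta>\<^sup>2 / 4)))"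
proof -
  obtain A where A: "A > 0" "\<And>n \<theta>. \<bar>\<theta>\<bar> \<le> 1 \<Longrightarrow> norm (geometric_poly n (exp (\<i> * of_real \<theta>)) / fact n
        - 1 / ((1 + exp (\<i> * of_real \<theta>)) * dominant_pole \<theta> ^ Suc n)) \<le> A"
    using geometric_poly_dominant_term by blast
  obtain B where B: "B > 0"
    "\<And>n \<theta>. \<bar>\<theta>\<bar> \<le> 1/2 \<Longrightarrow> \<exists>r. norm r \<le> B * (real n + 1) * \<theta> ^ 4 \<and>
       2 * of_real (ln 2) ^ (n + 1) / ((1 + exp (\<i> * of_real \<theta>)) * dominant_pole \<theta> ^ (n + 1)) =
       exp (\<i> * of_real (mean_a n * \<theta>) - of_real (var_b n * \<theta>\<^sup>2 / 2)
         - \<i> * of_real ((real n + 1) * ((2 - 3 * ln 2) / (2 * ln 2)^3) / 6 * \<theta>^3) + r)"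
    using dominant_term_expansion by blast
  define K where "K = \<bar>(2 - 3 * ln 2) / (2 * ln 2 :: real) ^ 3\<bar> / 6"
  define \<delta> where "\<delta> = min (1 / 2) (\<beta> / (4 * (K + B)))"
  have K: "K \<ge> 0" by (simp add: K_def)
  have \<delta>: "\<delta> > 0" "\<delta> \<le> 1 / 2" "\<delta> \<le> \<beta> / (4 * (K + B))"
    using \<beta> B(1) K by (simp_all only: \<delta>_def min.cobounded1 min.cobounded2) simp
  have cub: "\<bar>cubic_coeff n\<bar> \<le> K * (real n + 1)" for n
    by (simp add: cubic_coeff_def K_def abs_mult mult_ac)
  have "norm (centred_char n \<theta> - edgeworth_char n \<theta>) \<le> (2 * A) * ln 2 ^ n + ((K + B)\<^sup>2 + B) *
         (((real n + 1) * \<theta> ^ 4 + (real n + 1)\<^sup>2 * \<theta> ^ 6) * exp (- (\<beta> * (real n + 1) * \<theta>\<^sup>2 / 4)))"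
    if \<theta>: "\<bar>\<theta>\<bar> \<le> \<delta>" and b: "\<beta> * (real n + 1) \<le> var_b n" for n \<theta>
  proof -
    define u where "u = exp (\<i> * complex_of_real \<theta>)"
    define M where "M = 1 / ((1 + u) * dominant_pole \<theta> ^ Suc n)"
    define P where "P = geometric_poly n u / fact n"
    define s where "s = exp (- (\<i> * complex_of_real (mean_a n * \<theta>)))"
    have err: "norm (P - M) \<le> A"
      using A(2)[of \<theta> n] \<theta> \<delta> by (simp add: P_def M_def u_def)
    obtain r where r: "norm r \<le> B * (real n + 1) * \<theta> ^ 4"
      "2 * of_real (ln 2) ^ (n + 1) / ((1 + u) * dominant_pole \<theta> ^ (n + 1)) =
       exp (\<i> * of_real (mean_a n * \<theta>) - of_real (var_b n * \<theta>\<^sup>2 / 2)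
         - \<i> * of_real (cubic_coeff n * \<theta>^3) + r)"
      using B(2)[of \<theta> n] \<theta> \<delta> unfolding cubic_coeff_def u_def by force
    have Ms: "of_real (2 * ln 2 ^ (n + 1)) * M * s =
        exp (- of_real (var_b n * \<theta>\<^sup>2 / 2) - \<i> * of_real (cubic_coeff n * \<theta> ^ 3) + r)" (is "_ = ?X")
    proof -
      have "of_real (2 * ln 2 ^ (n + 1)) * M =
          2 * of_real (ln 2) ^ (n + 1) / ((1 + u) * dominant_pole \<theta> ^ (n + 1))"
        by (simp add: M_def)
      then show ?thesis unfolding r(2) s_def
        by (simp only: exp_add[symmetric]) (simp add: algebra_simps)
    qed
    have "(K + B) * \<bar>\<theta>\<bar> \<le> (K + B) * (\<beta> / (4 * (K + B)))"
      using \<theta> \<delta> K B(1) by (intro mult_left_mono) auto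
    also have "\<dots> = \<beta> / 4" using K B(1) by (simp add: field_simps)
    finally have small: "(K + B) * \<bar>\<theta>\<bar> \<le> \<beta> / 4" .
    have near: "norm (?X - edgeworth_char n \<theta>) \<le> ((K + B)\<^sup>2 + B) *
         (((real n + 1) * \<theta> ^ 4 + (real n + 1)\<^sup>2 * \<theta> ^ 6) * exp (- (\<beta> * (real n + 1) * \<theta>\<^sup>2 / 4)))"
      unfolding edgeworth_char_def
      by (rule exp_cubic_perturbation) (use b cub r(1) \<theta> \<delta> small K B(1) in auto)
    have "norm (s * (P - M)) \<le> A" using err by (simp add: norm_mult s_def)
    then have "norm (of_real (2 * ln 2 ^ (n + 1)) * (s * (P - M))) \<le> (2 * ln 2 ^ (n + 1)) * A"
      unfolding norm_mult[of "of_real _"] norm_of_real by (intro mult_mono) auto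
    also have "\<dots> = ln 2 * (2 * A * ln 2 ^ n)" by simp
    also have "\<dots> \<le> 1 * (2 * A * ln 2 ^ n)"
      using ln_2_less_1 A(1) by (intro mult_right_mono) auto
    finally have far: "norm (of_real (2 * ln 2 ^ (n + 1)) * (s * (P - M))) \<le> 2 * A * ln 2 ^ n" by simp
    have "centred_char n \<theta> - edgeworth_char n \<theta> =
        of_real (2 * ln 2 ^ (n + 1)) * (s * (P - M)) + (?X - edgeworth_char n \<theta>)"
      unfolding Ms[symmetric] centred_char_def P_def[symmetric] u_def[symmetric] s_def[symmetric]
      by (simp add: algebra_simps)
    also have "norm \<dots> \<le> 2 * A * ln 2 ^ n + ((K + B)\<^sup>2 + B) *
         (((real n + 1) * \<theta> ^ 4 + (real n + 1)\<^sup>2 * \<theta> ^ 6) * exp (- (\<beta> * (real n + 1) * \<theta>\<^sup>2 / 4)))"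
      by (rule norm_triangle_mono[OF far near])
    finally show ?thesis .
  qed
  then show ?thesis
    using that[of "2 * A" "(K + B)\<^sup>2 + B" \<delta>] A(1) B(1) \<delta>(1) by auto
qed

text \<open>For \<open>\<bar>\<theta>\<bar> \<le> \<delta>\<close> the two functions are close to each other; for larger \<open>\<theta>\<close> each of them is small on
  its own, and beyond \<open>\<pi>\<close> only the tail of the approximation is left. The lower bound on the variance
  enters as a hypothesis because it holds for large \<open>n\<close> only.\<close>

lemma centred_char_bound:
  assumes \<beta>: "\<beta> > 0"
  obtains A C q where "A \<ge> 0" "C \<ge> 0" "0 \<le> q" "q < 1"
    "\<And>n \<theta>. \<beta> * (real n + 1) \<le> var_b n \<Longrightarrow>
       norm (indicator {-pi..pi} \<theta> *\<^sub>R centred_char n \<theta> - edgeworth_char n \<theta>)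
       \<le> indicator {-pi..pi} \<theta> *\<^sub>R (A * q ^ n) +
         C * (((real n + 1) * \<theta> ^ 4 + (real n + 1)\<^sup>2 * \<theta> ^ 6) * exp (- (\<beta> * (real n + 1) * \<theta>\<^sup>2 / 4)))"
proof -
  obtain A0 C0 \<delta>' where near: "A0 \<ge> 0" "C0 \<ge> 0" "\<delta>' > 0"
    "\<And>n \<theta>. \<bar>\<theta>\<bar> \<le> \<delta>' \<Longrightarrow> \<beta> * (real n + 1) \<le> var_b n \<Longrightarrow>
       norm (centred_char n \<theta> - edgeworth_char n \<theta>) \<le> A0 * ln 2 ^ n +
         C0 * (((real n + 1) * \<theta> ^ 4 + (real n + 1)\<^sup>2 * \<theta> ^ 6) * exp (- (\<beta> * (real n + 1) * \<theta>\<^sup>2 / 4)))"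
    using centred_char_near_0[OF \<beta>] by blast
  define \<delta> where "\<delta> = min \<delta>' pi"
  have \<delta>: "\<delta> > 0" "\<delta> \<le> \<delta>'" "\<delta> \<le> pi" using near(3) by (auto simp: \<delta>_def)
  obtain A1 R where far: "A1 > 0" "R > ln 2"
    "\<And>n \<theta>. \<delta> \<le> \<bar>\<theta>\<bar> \<Longrightarrow> \<bar>\<theta>\<bar> \<le> pi \<Longrightarrow>
        norm (geometric_poly n (exp (\<i> * of_real \<theta>)) / fact n) \<le> A1 / R ^ n"
    using geometric_poly_away_from_one[OF \<delta>(1)] by blast
  define K where "K = \<bar>(2 - 3 * ln 2) / (2 * ln 2 :: real) ^ 3\<bar> / 6"
  have K: "K \<ge> 0" by (simp add: K_def)
  define C1 where "C1 = 1 / \<delta> ^ 4 + K / \<delta>"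
  have C1: "C1 \<ge> 0" using \<delta>(1) K by (simp add: C1_def)
  define q where "q = max (ln 2) (ln 2 / R)"
  have R0: "R > 0" using far(2) ln_gt_zero[of "2::real"] by linarith
  have q: "0 \<le> q" "q < 1" "ln 2 \<le> q" "ln 2 / R \<le> q"
    using far(2) R0 ln_2_less_1 ln_gt_zero[of "2::real"] by (auto simp: q_def le_max_iff_disj)
  define H where "H = (\<lambda>n \<theta>. ((real n + 1) * \<theta> ^ 4 + (real n + 1)\<^sup>2 * \<theta> ^ 6) * exp (- (\<beta> * (real n + 1) * \<theta>\<^sup>2 / 4)))"
  have H: "H n \<theta> \<ge> 0" for n \<theta>
    by (auto simp: H_def zero_le_even_power intro!: mult_nonneg_nonneg add_nonneg_nonneg)
  have tail: "norm (edgeworth_char n \<theta>) \<le> C1 * H n \<theta>"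
    if "\<delta> \<le> \<bar>\<theta>\<bar>" "\<beta> * (real n + 1) \<le> var_b n" for n \<theta>
    unfolding edgeworth_char_def H_def C1_def
    by (rule edgeworth_tail) (use that \<delta> \<beta> K in \<open>auto simp: cubic_coeff_def K_def abs_mult mult_ac\<close>)
  have "norm (indicator {-pi..pi} \<theta> *\<^sub>R centred_char n \<theta> - edgeworth_char n \<theta>)
       \<le> indicator {-pi..pi} \<theta> *\<^sub>R ((A0 + 2 * A1) * q ^ n) + (C0 + C1) * H n \<theta>"
    if b: "\<beta> * (real n + 1) \<le> var_b n" for n \<theta>
  proof -
    have le: "C0 * H n \<theta> \<le> (C0 + C1) * H n \<theta>" "C1 * H n \<theta> \<le> (C0 + C1) * H n \<theta>"
      using H[of n \<theta>] near(2) C1 by (auto intro: mult_right_mono)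
    consider "\<bar>\<theta>\<bar> \<le> \<delta>" | "\<delta> \<le> \<bar>\<theta>\<bar>" "\<bar>\<theta>\<bar> \<le> pi" | "\<bar>\<theta>\<bar> > pi" by linarith
    then show ?thesis
    proof cases
      case 1
      have "norm (centred_char n \<theta> - edgeworth_char n \<theta>) \<le> A0 * ln 2 ^ n + C0 * H n \<theta>"
        unfolding H_def using 1 \<delta> b by (intro near(4)) auto
      also have "A0 * ln 2 ^ n \<le> (A0 + 2 * A1) * q ^ n"
        using near(1) far(1) q by (intro mult_mono power_mono) auto
      finally have "norm (centred_char n \<theta> - edgeworth_char n \<theta>) \<le> (A0 + 2 * A1) * q ^ n + C0 * H n \<theta>"
        by simp
      moreover have "\<theta> \<in> {-pi..pi}" using 1 \<delta> by auto
      ultimately show ?thesis using le by simp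
    next
      case 2
      have "norm (centred_char n \<theta>) = (2 * ln 2 ^ (n + 1)) * norm (geometric_poly n (exp (\<i> * of_real \<theta>)) / fact n)"
        unfolding centred_char_def norm_mult norm_of_real by simp
      also have "\<dots> \<le> (2 * ln 2 ^ n) * (A1 / R ^ n)"
        using far(3)[OF 2] ln_2_less_1 by (intro mult_mono) (auto simp: mult_le_cancel_right1)
      also have "\<dots> = 2 * A1 * (ln 2 / R) ^ n" by (simp add: power_divide)
      also have "\<dots> \<le> (A0 + 2 * A1) * q ^ n"
        using near(1) far(1) q R0 by (intro mult_mono power_mono) auto
      finally have "norm (centred_char n \<theta> - edgeworth_char n \<theta>) \<le> (A0 + 2 * A1) * q ^ n + C1 * H n \<theta>"
        using tail[OF 2(1) b] norm_triangle_ineq4[of "centred_char n \<theta>" "edgeworth_char n \<theta>"] by linarith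
      moreover have "\<theta> \<in> {-pi..pi}" using 2 by auto
      ultimately show ?thesis using le by simp
    next
      case 3
      then have "\<theta> \<notin> {-pi..pi}" by auto
      then show ?thesis using tail[of \<theta> n] b 3 \<delta> le by simp
    qed
  qed
  then show ?thesis
    using that[of "A0 + 2 * A1" "C0 + C1" q] near(1,2) far(1) C1 q unfolding H_def by auto
qed

lemma fact_Stirling_as_integral:
  "complex_of_real (2 * fact_Stirling n j * ln 2 ^ (n + 1) / fact n) = of_real (1 / (2 * pi)) *
     (CLBINT \<theta>. exp (- (\<i> * of_real (\<theta> * (of_int j - mean_a n)))) * (indicator {-pi..pi} \<theta> *\<^sub>R centred_char n \<theta>))"
proof -
  define c where "c = complex_of_real (2 * ln 2 ^ (n + 1) / fact n)"
  have "exp (- (\<i> * of_real (\<theta> * (of_int j - mean_a n)))) * (indicator {-pi..pi} \<theta> *\<^sub>R centred_char n \<theta>)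
      = c * (indicator {-pi..pi} \<theta> *\<^sub>R
        (geometric_poly n (exp (\<i> * of_real \<theta>)) * exp (- (\<i> * of_real (\<theta> * of_int j)))))" for \<theta> :: real
  proof -
    have "exp (- (\<i> * of_real (\<theta> * (of_int j - mean_a n)))) * exp (- (\<i> * of_real (mean_a n * \<theta>)))
        = exp (- (\<i> * complex_of_real (\<theta> * of_int j)))"
      unfolding exp_add[symmetric] by (simp add: algebra_simps)
    then have "exp (- (\<i> * of_real (\<theta> * (of_int j - mean_a n)))) * centred_char n \<theta>
       = c * (geometric_poly n (exp (\<i> * of_real \<theta>)) * exp (- (\<i> * of_real (\<theta> * of_int j))))"
      unfolding centred_char_def c_def by (simp add: field_simps)
    then show ?thesis by (simp only: mult_scaleR_right)
  qed
  then have "(CLBINT \<theta>. exp (- (\<i> * of_real (\<theta> * (of_int j - mean_a n)))) * (indicator {-pi..pi} \<theta> *\<^sub>R centred_char n \<theta>))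
      = c * (CLBINT \<theta>. indicator {-pi..pi} \<theta> *\<^sub>R
        (geometric_poly n (exp (\<i> * of_real \<theta>)) * exp (- (\<i> * of_real (\<theta> * of_int j)))))"
    by (simp only: integral_mult_right_zero)
  then show ?thesis
    using fact_Stirling_fourier[of n j] by (simp add: c_def)
qed

text \<open>Both quantities are Fourier integrals with the kernel \<open>e\<^sup>-\<^sup>i\<^sup>\<theta>\<^sup>y\<close>, \<open>y = j - a\<^sub>n\<close>. Since the kernel has modulus
  1, their difference is bounded by the integral of the majorant in \<open>centred_char_bound\<close>,
  which does not involve \<open>j\<close>.\<close>

lemma edgeworth_error_bound:
  assumes \<beta>: "\<beta> > 0"
  obtains A D q where "A \<ge> 0" "D \<ge> 0" "0 \<le> q" "q < 1"
    "\<And>n j. n > 0 \<Longrightarrow> \<beta> * (real n + 1) \<le> var_b n \<Longrightarrow>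
       \<bar>2 * sqrt (var_b n) * fact_Stirling n j * ln 2 ^ (n + 1) / fact n
         - 1 / sqrt (2 * pi) * exp (- (std_x n j ^ 2) / 2) *
                (1 + skew_c n * (std_x n j ^ 3 - 3 * std_x n j) / (6 * sqrt (real n)))\<bar>
       \<le> sqrt (var_b n) * (A * q ^ n + D / ((real n + 1) * sqrt (real n + 1)))"
proof -
  obtain A C q where A: "A \<ge> 0" "C \<ge> 0" "0 \<le> q" "q < 1" and
    bound: "\<And>n \<theta>. \<beta> * (real n + 1) \<le> var_b n \<Longrightarrow>
       norm (indicator {-pi..pi} \<theta> *\<^sub>R centred_char n \<theta> - edgeworth_char n \<theta>)
       \<le> indicator {-pi..pi} \<theta> *\<^sub>R (A * q ^ n) +
         C * (((real n + 1) * \<theta> ^ 4 + (real n + 1)\<^sup>2 * \<theta> ^ 6) * exp (- (\<beta> * (real n + 1) * \<theta>\<^sup>2 / 4)))"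
    using centred_char_bound[OF \<beta>] by blast
  obtain I where I: "\<And>N. N > 0 \<Longrightarrow>
     has_bochner_integral lborel (\<lambda>\<theta>. (N * \<theta> ^ 4 + N\<^sup>2 * \<theta> ^ 6) * exp (- (\<beta> * N * \<theta>\<^sup>2 / 4))) (I / (N * sqrt N))"
    using integral_scaled_moments[OF \<beta>] by blast
  define D where "D = C * \<bar>I\<bar> / (2 * pi)"
  have "\<bar>2 * sqrt (var_b n) * fact_Stirling n j * ln 2 ^ (n + 1) / fact n
         - 1 / sqrt (2 * pi) * exp (- (std_x n j ^ 2) / 2) *
                (1 + skew_c n * (std_x n j ^ 3 - 3 * std_x n j) / (6 * sqrt (real n)))\<bar>
       \<le> sqrt (var_b n) * (A * q ^ n + D / ((real n + 1) * sqrt (real n + 1)))"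
    if n: "n > 0" and b: "\<beta> * (real n + 1) \<le> var_b n" for n j
  proof -
    define N where "N = real n + 1"
    have N: "N > 0" by (simp add: N_def)
    have b0: "var_b n > 0" using b \<beta> N unfolding N_def by (smt (verit) mult_pos_pos)
    define y where "y = of_int j - mean_a n"
    define e where "e = (\<lambda>\<theta>. exp (- (\<i> * complex_of_real (\<theta> * y))))"
    define f where "f = (\<lambda>\<theta>. e \<theta> * (indicator {-pi..pi} \<theta> *\<^sub>R centred_char n \<theta>))"
    define g where "g = (\<lambda>\<theta>. e \<theta> * edgeworth_char n \<theta>)"
    define H where "H = (\<lambda>\<theta>. indicator {-pi..pi} \<theta> *\<^sub>R (A * q ^ n) +
         C * ((N * \<theta> ^ 4 + N\<^sup>2 * \<theta> ^ 6) * exp (- (\<beta> * N * \<theta>\<^sup>2 / 4))))"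
    have x: "y / sqrt (var_b n) = std_x n j" by (simp add: y_def std_x_def)
    have skew: "cubic_coeff n / sqrt (var_b n) ^ 3 = skew_c n / (6 * sqrt (real n))"
      using n b0 by (simp add: cubic_coeff_def skew_c_def field_simps power_mult_distrib)
    note ed = edgeworth_density_fourier[OF b0, where y = y and \<nu> = "cubic_coeff n", unfolded x skew]
    have g_int: "integrable lborel g"
      using ed(1) unfolding g_def e_def edgeworth_char_def .
    have f_eq: "f = (\<lambda>\<theta>. indicator {-pi..pi} \<theta> *\<^sub>R (e \<theta> * centred_char n \<theta>))"
      by (auto simp: f_def fun_eq_iff)
    have f_int: "integrable lborel f"
      unfolding f_eq e_def centred_char_def geometric_poly_def
      by (intro borel_integrable_compact continuous_intros) auto
    have H_int: "has_bochner_integral lborel H (2 * pi * (A * q ^ n) + C * (I / (N * sqrt N)))"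
    proof -
      have "has_bochner_integral lborel (\<lambda>\<theta>. indicator {-pi..pi} \<theta> *\<^sub>R (A * q ^ n)) (measure lborel {-pi..pi} *\<^sub>R (A * q ^ n))"
        by (rule has_bochner_integral_indicator) auto
      then show ?thesis
        unfolding H_def using has_bochner_integral_add[OF _ has_bochner_integral_mult_right[OF I[OF N]]] by force
    qed
    have "complex_of_real (2 * sqrt (var_b n) * fact_Stirling n j * ln 2 ^ (n + 1) / fact n)
        = of_real (sqrt (var_b n)) * of_real (2 * fact_Stirling n j * ln 2 ^ (n + 1) / fact n)"
      by simp
    also have "\<dots> = of_real (sqrt (var_b n)) * (of_real (1 / (2 * pi)) * integral\<^sup>L lborel f)"
      unfolding fact_Stirling_as_integral f_def e_def y_def ..
    also have "\<dots> = of_real (sqrt (var_b n) / (2 * pi)) * integral\<^sup>L lborel f"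
      by simp
    finally have main: "complex_of_real (2 * sqrt (var_b n) * fact_Stirling n j * ln 2 ^ (n + 1) / fact n) = \<dots>" .
    have edge: "complex_of_real (1 / sqrt (2 * pi) * exp (- (std_x n j ^ 2) / 2) *
                (1 + skew_c n * (std_x n j ^ 3 - 3 * std_x n j) / (6 * sqrt (real n))))
      = of_real (sqrt (var_b n) / (2 * pi)) * integral\<^sup>L lborel g"
      using ed(2)[symmetric] unfolding g_def e_def edgeworth_char_def by (simp only: times_divide_eq_left)
    have "complex_of_real (2 * sqrt (var_b n) * fact_Stirling n j * ln 2 ^ (n + 1) / fact n
        - 1 / sqrt (2 * pi) * exp (- (std_x n j ^ 2) / 2) *
                (1 + skew_c n * (std_x n j ^ 3 - 3 * std_x n j) / (6 * sqrt (real n))))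
      = of_real (sqrt (var_b n) / (2 * pi)) * integral\<^sup>L lborel f - of_real (sqrt (var_b n) / (2 * pi)) * integral\<^sup>L lborel g"
      unfolding of_real_diff main edge ..
    also have "\<dots> = of_real (sqrt (var_b n) / (2 * pi)) * (CLBINT \<theta>. f \<theta> - g \<theta>)"
      using f_int g_int by (simp add: right_diff_distrib)
    finally have "\<bar>2 * sqrt (var_b n) * fact_Stirling n j * ln 2 ^ (n + 1) / fact n
        - 1 / sqrt (2 * pi) * exp (- (std_x n j ^ 2) / 2) *
                (1 + skew_c n * (std_x n j ^ 3 - 3 * std_x n j) / (6 * sqrt (real n)))\<bar>
      = norm (of_real (sqrt (var_b n) / (2 * pi)) * (CLBINT \<theta>. f \<theta> - g \<theta>))"
      by - (drule arg_cong[where f = norm], simp only: norm_of_real)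
    also have "\<dots> = sqrt (var_b n) / (2 * pi) * norm (CLBINT \<theta>. f \<theta> - g \<theta>)"
      unfolding norm_mult norm_of_real using b0 by simp
    also have "\<dots> \<le> sqrt (var_b n) / (2 * pi) * integral\<^sup>L lborel H"
    proof (rule mult_left_mono)
      have dom: "norm (f \<theta> - g \<theta>) \<le> H \<theta>" for \<theta>
      proof -
        have "norm (f \<theta> - g \<theta>) = norm (indicator {-pi..pi} \<theta> *\<^sub>R centred_char n \<theta> - edgeworth_char n \<theta>)"
          unfolding f_def g_def right_diff_distrib[symmetric] norm_mult by (simp add: e_def)
        also have "\<dots> \<le> H \<theta>"
          unfolding H_def N_def by (rule bound[OF b])
        finally show ?thesis .
      qed
      show "norm (CLBINT \<theta>. f \<theta> - g \<theta>) \<le> integral\<^sup>L lborel H"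
        using f_int g_int H_int dom
        by (intro Bochner_Integration.integral_norm_bound_integral) (auto simp: has_bochner_integral_iff)
    qed (use b0 in auto)
    also have "integral\<^sup>L lborel H = 2 * pi * (A * q ^ n) + C * (I / (N * sqrt N))"
      using H_int by (rule has_bochner_integral_integral_eq)
    also have "\<dots> \<le> 2 * pi * (A * q ^ n) + C * (\<bar>I\<bar> / (N * sqrt N))"
      using A(2) N by (intro add_left_mono mult_left_mono divide_right_mono) auto
    also have "\<dots> = 2 * pi * (A * q ^ n + D / (N * sqrt N))"
      by (simp add: D_def field_simps)
    also have "sqrt (var_b n) / (2 * pi) * (2 * pi * (A * q ^ n + D / (N * sqrt N)))
        = sqrt (var_b n) * (A * q ^ n + D / (N * sqrt N))"
      by simp
    finally show ?thesis using b0 unfolding N_def by (simp add: divide_right_mono mult_left_mono)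
  qed
  then show ?thesis using that[of A D q] A by (simp add: D_def)
qed

text \<open>Half of the growth rate of \<open>b\<^sub>n\<close> serves as \<open>\<beta>\<close>; the other half absorbs the constant \<open>- 1/4\<close>.\<close>

lemma var_b_bounds:
  obtains \<beta> where "\<beta> > 0" "eventually (\<lambda>n. \<beta> * (real n + 1) \<le> var_b n) sequentially"
    "\<And>n. var_b n \<le> real n + 1"
proof -
  define v where "v = (1 - ln 2) / (2 * ln 2 :: real) ^ 2"
  have v0: "v > 0" using ln_2_less_1 by (simp add: v_def)
  have "ln (2::real) \<ge> 1 / 2" by (subst ln_ge_iff) (use exp_half_le2 in auto)
  then have "1 \<le> (2 * ln 2 :: real) ^ 2" by (intro one_le_power) simp
  moreover have "ln (2::real) > 0" by simp
  ultimately have "1 - ln 2 \<le> (2 * ln 2 :: real) ^ 2" "(2 * ln 2 :: real) ^ 2 > 0" by linarith+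
  then have v1: "v \<le> 1" unfolding v_def by (subst divide_le_eq_1_pos)
  have var: "var_b n = v * (real n + 1) - 1 / 4" for n by (simp add: var_b_def v_def)
  have "eventually (\<lambda>n. 1 / (2 * v) \<le> real n) sequentially"
    using filterlim_real_sequentially unfolding filterlim_at_top by blast
  then have "eventually (\<lambda>n. v / 2 * (real n + 1) \<le> var_b n) sequentially"
  proof eventually_elim
    case (elim n)
    then have "1 / 2 \<le> v * real n" using v0 by (simp add: field_simps)
    then show ?case unfolding var using v0 by (simp add: field_simps)
  qed
  moreover have "var_b n \<le> real n + 1" for n
  proof -
    have le: "v * (real n + 1) \<le> 1 * (real n + 1)" using v1 by (intro mult_right_mono) auto
    have "v * (real n + 1) - 1 / 4 \<le> v * (real n + 1)" by simp
    from order_trans[OF this le] show ?thesis unfolding var by (simp only: mult_1)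
  qed
  ultimately show ?thesis using that[of "v / 2"] v0 by simp
qed

theorem theorem5p3:
  "uniform_limit (UNIV :: int set)
     (\<lambda>n j. sqrt (real n) *
        (2 * sqrt (var_b n) * fact_Stirling n j * ln 2 ^ (n + 1) / fact n
         - (let x = std_x n j in
              1 / sqrt (2 * pi) * exp (- (x ^ 2) / 2) *
                (1 + skew_c n * (x ^ 3 - 3 * x) / (6 * sqrt (real n))))))
     (\<lambda>_. 0) sequentially"
proof -
  obtain \<beta> where \<beta>: "\<beta> > 0" "eventually (\<lambda>n. \<beta> * (real n + 1) \<le> var_b n) sequentially"
    "\<And>n. var_b n \<le> real n + 1"
    using var_b_bounds by blast
  obtain A D q where A: "A \<ge> 0" "D \<ge> 0" "0 \<le> q" "q < 1" and
    bound: "\<And>n j. n > 0 \<Longrightarrow> \<beta> * (real n + 1) \<le> var_b n \<Longrightarrow>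
       \<bar>2 * sqrt (var_b n) * fact_Stirling n j * ln 2 ^ (n + 1) / fact n
         - 1 / sqrt (2 * pi) * exp (- (std_x n j ^ 2) / 2) *
                (1 + skew_c n * (std_x n j ^ 3 - 3 * std_x n j) / (6 * sqrt (real n)))\<bar>
       \<le> sqrt (var_b n) * (A * q ^ n + D / ((real n + 1) * sqrt (real n + 1)))"
    using edgeworth_error_bound[OF \<beta>(1)] by blast
  define E where "E = (\<lambda>n. A * (real n * q ^ n) + A * q ^ n + D / sqrt (real n + 1))"
  have "(\<lambda>n. real n * q ^ n) \<longlonglongrightarrow> 0" "(\<lambda>n. q ^ n) \<longlonglongrightarrow> 0"
    using powser_times_n_limit_0[of q] LIMSEQ_realpow_zero[of q] A by auto
  moreover have "(\<lambda>n. 1 / sqrt (real n + 1)) \<longlonglongrightarrow> 0" by real_asymp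
  ultimately have "(\<lambda>n. A * (real n * q ^ n) + A * q ^ n + D * (1 / sqrt (real n + 1))) \<longlonglongrightarrow> A * 0 + A * 0 + D * 0"
    by (intro tendsto_add tendsto_mult_left)
  then have E: "E \<longlonglongrightarrow> 0" by (simp add: E_def)
  show ?thesis
  proof (rule uniform_limitI)
    fix \<epsilon> :: real assume "\<epsilon> > 0"
    with E have "eventually (\<lambda>n. E n < \<epsilon>) sequentially"
      by (rule order_tendstoD)
    with \<beta>(2) eventually_gt_at_top[of 0]
    show "\<forall>\<^sub>F n in sequentially. \<forall>j\<in>UNIV. dist (sqrt (real n) *
        (2 * sqrt (var_b n) * fact_Stirling n j * ln 2 ^ (n + 1) / fact n
         - (let x = std_x n j in
              1 / sqrt (2 * pi) * exp (- (x ^ 2) / 2) *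
                (1 + skew_c n * (x ^ 3 - 3 * x) / (6 * sqrt (real n)))))) 0 < \<epsilon>"
    proof eventually_elim
      case (elim n)
      define N where "N = real n + 1"
      have N: "N > 0" "real n \<le> N" by (simp_all add: N_def)
      have "sqrt (real n) * \<bar>2 * sqrt (var_b n) * fact_Stirling n j * ln 2 ^ (n + 1) / fact n
         - 1 / sqrt (2 * pi) * exp (- (std_x n j ^ 2) / 2) *
                (1 + skew_c n * (std_x n j ^ 3 - 3 * std_x n j) / (6 * sqrt (real n)))\<bar> \<le> E n" (is "_ * ?d \<le> _") for j
      proof -
        have X: "0 \<le> A * q ^ n + D / (N * sqrt N)" using A N by simp
        have "sqrt (real n) * ?d \<le> sqrt N * (sqrt N * (A * q ^ n + D / (N * sqrt N)))"
        proof (rule mult_mono)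
          have "?d \<le> sqrt (var_b n) * (A * q ^ n + D / (N * sqrt N))"
            unfolding N_def by (rule bound) (use elim in auto)
          also have "\<dots> \<le> sqrt N * (A * q ^ n + D / (N * sqrt N))"
            using \<beta>(3)[of n] by (intro mult_right_mono X) (simp add: N_def)
          finally show "?d \<le> sqrt N * (A * q ^ n + D / (N * sqrt N))" .
        qed (use N in auto)
        also have "\<dots> = (sqrt N * sqrt N) * (A * q ^ n + D / (N * sqrt N))" by (simp only: mult.assoc)
        also have "\<dots> = N * (A * q ^ n + D / (N * sqrt N))" using N by simp
        also have "\<dots> = E n" using N(1) by (simp add: E_def field_simps flip: N_def) (simp add: N_def algebra_simps)
        finally show ?thesis .
      qed
      with elim(3) show ?case
        by (auto simp: Let_def dist_real_def abs_mult intro: order.strict_trans1)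
    qed
  qed
qed

end
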